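(* Consider the problem $\min_{x\in X}P(x)$ with $P(x)=\max_{y\in Y}f(x,y)$ described in the context. Assume that: (1) $x_0\in X$ and $\epsilon_0>0$ satisfy $P(x_0)-P^*\le\epsilon_0$; (2) the stochastic subgradients satisfy $\|\nabla_x f(x,y;\xi)\|\le M$ and $\|\nabla_y f(x,y;\xi)\|\le B$ for all $x\in X$, $y\in Y$ and all $\xi$; (3) $\phi^*$ is $\lambda_\phi$-strongly convex with $\lambda_\phi>0$, so that $\phi$ is differentiable with $L$-Lipschitz continuous gradient, $L=1/\lambda_\phi$; (4) $\ell$ is $G$-Lipschitz continuous on $X$; (5) $P$ is $\mu$-strongly convex on $X$ with $\mu>0$. Let $0<\epsilon<\epsilon_0$, $S=\lceil\log_2(\epsilon_0/\epsilon)\rceil$ and $$T_1=\frac{\max\{405M^2,\;810L^2G^2B^2\}}{\mu\epsilon_0}$$ (rounded up to an integer). Then the output $\bar x_S$ of the algorithm RSPD$^{\mathrm{sc}}$ described in the context, run with $x_0$, $S$, $T_1$, $\epsilon_0$, satisfies $$\mathbb{E}[P(\bar x_S)-P^*]\le\epsilon,$$ and the total number of iterations $\sum_{s=1}^S T_s$ is $O\!\left(\frac{1}{\mu\epsilon}\right)$.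
   Context: Setting. $X\subseteq\mathbb{R}^d$ is a closed convex set; $\ell=(\ell_1,\dots,\ell_n)^\top:X\to\mathbb{R}^n$ has lower-semicontinuous convex components; $g:X\to\mathbb{R}$ is lower-semicontinuous and convex; $\phi^*$ is a convex function with domain $Y=\mathrm{dom}(\phi^* )\subseteq\mathbb{R}^n$ (closed, so that projections onto it are defined), and $\phi^*$ and $\phi$ are convex conjugates of each other. If $\ell$ is not affine, $Y\subseteq\mathbb{R}^n_+$. Put $$f(x,y)=y^\top\ell(x)-\phi^*(y)+g(x),\qquad P(x)=\phi(\ell(x))+g(x)=\max_{y\in Y}f(x,y).$$ $P^*$ is the minimum of $P$ over $X$, attained on the nonempty set $X^*$. $\|\cdot\|$ is the Euclidean norm, $\Pi_\Omega$ is Euclidean projection onto $\Omega$. Strong convexity. $h$ is $\lambda$-strongly convex if $h(x_1)\ge h(x_2)+\partial h(x_2)^\top(x_1-x_2)+\frac{\lambda}{2}\|x_1-x_2\|^2$ for all $x_1,x_2$ and any subgradient $\partial h(x_2)$. Stochastic subgradients. $\nabla_x f(x,y;\xi)$ and $\nabla_y f(x,y;\xi)$ are stochastic subgradients of $f$ with respect to $x$ and $y$: their expectations over $\xi$ are, respectively, a subgradient of $f(\cdot,y)$ at $x$ and a supergradient of $f(x,\cdot)$ at $y$. The samples $\xi_t^s$ used by the algorithm are drawn independently of the past. $M,B>0$. Dual map. $\mathcal A(x)=\arg\max_{y\in Y}\{y^\top\ell(x)-\phi^*(y)\}$. Algorithm RSPD$^{\mathrm{sc}}$. Initialize $x_0^{(1)}=x_0$,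 $y_0^{(1)}=\mathcal A(x_0^{(1)})$, $\eta_{x,1}=\frac{2\epsilon_0}{45M^2}$, $\eta_{y,1}=\frac{2\epsilon_0}{45B^2}$. For $s=1,\dots,S$: for $t=0,\dots,T_s-1$ set $$x_{t+1}^{(s)}=\Pi_X\big(x_t^{(s)}-\eta_{x,s}\nabla_xf(x_t^{(s)},y_t^{(s)};\xi_t^s)\big),\qquad y_{t+1}^{(s)}=\Pi_Y\big(y_t^{(s)}+\eta_{y,s}\nabla_yf(x_t^{(s)},y_t^{(s)};\xi_t^s)\big);$$ then set $x_0^{(s+1)}=\bar x_s=\frac{1}{T_s}\sum_{t=0}^{T_s-1}x_t^{(s)}$, $y_0^{(s+1)}=\mathcal A(x_0^{(s+1)})$, $\eta_{x,s+1}=\eta_{x,s}/2$, $\eta_{y,s+1}=\eta_{y,s}/2$, $T_{s+1}=2T_s$. Output $\bar x_S$. In the $O(\cdot)$ bound, the dependence on $M,B,L,G,\epsilon_0$ is suppressed.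
   Formalization: The O(1/(με)) bound is proved uniformly over 0<μ≤μ_max and 0<ε<ε_0 for every μ_max, with a constant depending also on μ_max; since T_1 is rounded up to at least 1, no constant works for all μ>0 at once. *)

theory Defs
  imports "HOL-Probability.Probability" "HOL-Library.Landau_Symbols"
begin

section \<open>Convex analysis\<close>

definition lsc_on :: "'a::topological_space set \<Rightarrow> ('a \<Rightarrow> real) \<Rightarrow> bool" where
  "lsc_on S h \<longleftrightarrow> (\<forall>x\<in>S. \<forall>c<h x. eventually (\<lambda>z. c < h z) (at x within S))"

definition affine_map_on :: "(real^'d) set \<Rightarrow> (real^'d \<Rightarrow> real^'n) \<Rightarrow> bool" where
  "affine_map_on S l \<longleftrightarrow> (\<exists>A b. \<forall>x\<in>S. l x = A *v x + b)"

text \<open>A function with effective domain \<open>S\<close> is given by its finite values on \<open>S\<close>;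
  its values outside \<open>S\<close> are irrelevant and are replaced by \<open>\<infinity>\<close> here.\<close>

definition extend_infty :: "'a set \<Rightarrow> ('a \<Rightarrow> real) \<Rightarrow> 'a \<Rightarrow> ereal" where
  "extend_infty S h x = (if x \<in> S then ereal (h x) else \<infinity>)"

definition convex_conjugate :: "('a::real_inner \<Rightarrow> ereal) \<Rightarrow> 'a \<Rightarrow> ereal" where
  "convex_conjugate h u = (SUP y. ereal (u \<bullet> y) - h y)"

text \<open>Sub- and supergradients of a function with domain \<open>S\<close>: the inequality is
  required on \<open>S\<close> only.\<close>

definition subgradients :: "'a::real_inner set \<Rightarrow> ('a \<Rightarrow> real) \<Rightarrow> 'a \<Rightarrow> 'a set" where
  "subgradients S h x = {v. \<forall>z\<in>S. h z \<ge> h x + v \<bullet> (z - x)}"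

definition supergradients :: "'a::real_inner set \<Rightarrow> ('a \<Rightarrow> real) \<Rightarrow> 'a \<Rightarrow> 'a set" where
  "supergradients S h x = {v. \<forall>z\<in>S. h z \<le> h x + v \<bullet> (z - x)}"

definition strongly_convex_on :: "'a::real_inner set \<Rightarrow> real \<Rightarrow> ('a \<Rightarrow> real) \<Rightarrow> bool" where
  "strongly_convex_on S c h \<longleftrightarrow>
     (\<forall>x1\<in>S. \<forall>x2\<in>S. \<forall>v\<in>subgradients S h x2.
        h x1 \<ge> h x2 + v \<bullet> (x1 - x2) + c / 2 * (norm (x1 - x2))\<^sup>2)"


section \<open>The saddle-point problem\<close>

definition saddle_fun ::
  "('a \<Rightarrow> 'b::real_inner) \<Rightarrow> ('b \<Rightarrow> real) \<Rightarrow> ('a \<Rightarrow> real) \<Rightarrow> 'a \<Rightarrow> 'b \<Rightarrow> real" where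
  "saddle_fun l phis g x y = y \<bullet> l x - phis y + g x"

definition primal_fun :: "('a \<Rightarrow> 'b) \<Rightarrow> ('b \<Rightarrow> real) \<Rightarrow> ('a \<Rightarrow> real) \<Rightarrow> 'a \<Rightarrow> real" where
  "primal_fun l phi g x = phi (l x) + g x"

definition dual_map ::
  "'b::real_inner set \<Rightarrow> ('a \<Rightarrow> 'b) \<Rightarrow> ('b \<Rightarrow> real) \<Rightarrow> 'a \<Rightarrow> 'b" where
  "dual_map Y l phis x = arg_max_on (\<lambda>y. y \<bullet> l x - phis y) Y"

lemma primal_fun_eq_SUP:
  fixes l :: "'a \<Rightarrow> 'b::real_inner"
  assumes conj: "convex_conjugate (extend_infty Y phis) = (\<lambda>u. ereal (phi u))"
  shows "Y \<noteq> {}"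
    and "y \<in> Y \<Longrightarrow> saddle_fun l phis g x y \<le> primal_fun l phi g x"
    and "primal_fun l phi g x = (SUP y\<in>Y. saddle_fun l phis g x y)"
proof -
  have eq: "(SUP y. ereal (l x \<bullet> y) - extend_infty Y phis y) = ereal (phi (l x))"
    using fun_cong[OF conj, of "l x"] by (simp add: convex_conjugate_def)
  show ne: "Y \<noteq> {}"
  proof
    assume "Y = {}"
    then show False using eq by (simp add: extend_infty_def)
  qed
  have ub: "saddle_fun l phis g x y \<le> primal_fun l phi g x" if "y \<in> Y" for y
  proof -
    have "ereal (l x \<bullet> y) - extend_infty Y phis y \<le> ereal (phi (l x))"
      unfolding eq[symmetric] by (rule SUP_upper) simp
    then show ?thesis
      using that by (simp add: extend_infty_def saddle_fun_def primal_fun_def inner_commute)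
  qed
  then show "y \<in> Y \<Longrightarrow> saddle_fun l phis g x y \<le> primal_fun l phi g x" .
  show "primal_fun l phi g x = (SUP y\<in>Y. saddle_fun l phis g x y)"
  proof (rule sym, rule cSup_eq_non_empty)
    fix c assume c: "\<And>r. r \<in> saddle_fun l phis g x ` Y \<Longrightarrow> r \<le> c"
    have "ereal (phi (l x)) \<le> ereal (c - g x)"
      unfolding eq[symmetric]
    proof (rule SUP_least)
      fix y show "ereal (l x \<bullet> y) - extend_infty Y phis y \<le> ereal (c - g x)"
        using c[of "saddle_fun l phis g x y"]
        by (cases "y \<in> Y") (auto simp: extend_infty_def saddle_fun_def inner_commute)
    qed
    then show "primal_fun l phi g x \<le> c" by (simp add: primal_fun_def)
  qed (use ne ub in auto)
qed


section \<open>The restarted stochastic primal-dual method\<close>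

text \<open>\<open>zeta t\<close> is the sample used in step \<open>t\<close> of a stage, and \<open>Gx x y z\<close>, \<open>Gy x y z\<close>
  are the stochastic subgradients at \<open>(x, y)\<close> for the sample \<open>z\<close>.\<close>

primrec spd_iter ::
  "'a::euclidean_space set \<Rightarrow> 'b::euclidean_space set \<Rightarrow>
   ('a \<Rightarrow> 'b \<Rightarrow> 'c \<Rightarrow> 'a) \<Rightarrow> ('a \<Rightarrow> 'b \<Rightarrow> 'c \<Rightarrow> 'b) \<Rightarrow> real \<Rightarrow> real \<Rightarrow>
   'a \<times> 'b \<Rightarrow> (nat \<Rightarrow> 'c) \<Rightarrow> nat \<Rightarrow> 'a \<times> 'b" where
  "spd_iter X Y Gx Gy etax etay xy0 zeta 0 = xy0"
| "spd_iter X Y Gx Gy etax etay xy0 zeta (Suc t) =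
     (let (x, y) = spd_iter X Y Gx Gy etax etay xy0 zeta t
      in (closest_point X (x - etax *\<^sub>R Gx x y (zeta t)),
          closest_point Y (y + etay *\<^sub>R Gy x y (zeta t))))"

text \<open>Stages are numbered from 1.\<close>

definition stage_length :: "nat \<Rightarrow> nat \<Rightarrow> nat" where
  "stage_length T1 s = 2 ^ (s - 1) * T1"

text \<open>\<open>rspd_out \<dots> s\<close> is the averaged iterate produced by stage \<open>s\<close>, which is also the
  initial primal point of stage \<open>Suc s\<close>; \<open>etax1\<close> and \<open>etay1\<close> are the step sizes of stage 1,
  \<open>A\<close> is the dual map, and \<open>zeta s t\<close> is the sample used in step \<open>t\<close> of stage \<open>s\<close>.\<close>

primrec rspd_out ::
  "'a::euclidean_space set \<Rightarrow> 'b::euclidean_space set \<Rightarrow>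
   ('a \<Rightarrow> 'b \<Rightarrow> 'c \<Rightarrow> 'a) \<Rightarrow> ('a \<Rightarrow> 'b \<Rightarrow> 'c \<Rightarrow> 'b) \<Rightarrow> ('a \<Rightarrow> 'b) \<Rightarrow> real \<Rightarrow> real \<Rightarrow>
   nat \<Rightarrow> 'a \<Rightarrow> (nat \<Rightarrow> nat \<Rightarrow> 'c) \<Rightarrow> nat \<Rightarrow> 'a" where
  "rspd_out X Y Gx Gy A etax1 etay1 T1 x0 zeta 0 = x0"
| "rspd_out X Y Gx Gy A etax1 etay1 T1 x0 zeta (Suc s) =
     (let x = rspd_out X Y Gx Gy A etax1 etay1 T1 x0 zeta s;
          T = stage_length T1 (Suc s)
      in (1 / real T) *\<^sub>R
         (\<Sum>t<T. fst (spd_iter X Y Gx Gy (etax1 / 2 ^ s) (etay1 / 2 ^ s) (x, A x)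
                        (zeta (Suc s)) t)))"

definition num_stages :: "real \<Rightarrow> real \<Rightarrow> nat" where
  "num_stages eps0 eps = nat \<lceil>log 2 (eps0 / eps)\<rceil>"

definition first_stage_length :: "real \<Rightarrow> real \<Rightarrow> real \<Rightarrow> real \<Rightarrow> real \<Rightarrow> real \<Rightarrow> nat" where
  "first_stage_length M B L G mu eps0 =
     nat \<lceil>max (405 * M\<^sup>2) (810 * L\<^sup>2 * G\<^sup>2 * B\<^sup>2) / (mu * eps0)\<rceil>"

definition total_iterations ::
    "real \<Rightarrow> real \<Rightarrow> real \<Rightarrow> real \<Rightarrow> real \<Rightarrow> real \<Rightarrow> real \<Rightarrow> nat" where
  "total_iterations M B L G eps0 mu eps =
     (\<Sum>s=1..num_stages eps0 eps. stage_length (first_stage_length M B L G mu eps0) s)"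

end

theory Submission
  imports Defs
begin

text \<open>
  Bounded subgradients and strong convexity force \<open>X\<close> and \<open>Y\<close> to be bounded, and strong convexity
  of \<open>\<phi>\<^sup>*\<close> makes the dual map \<open>A\<close> Lipschitz with constant \<open>L G\<close>.
  In a stage of length \<open>T\<close> started at \<open>x\<close> with averaged iterate \<open>x'\<close>, the regret bounds of the
  projected primal and dual steps add up to
  \<open>T (P x' - P\<^sup>*) \<le> |x - x\<^sup>*|\<^sup>2 / (2 \<eta>\<^sub>x) + |A x - A x'|\<^sup>2 / \<eta>\<^sub>y
    + T (\<eta>\<^sub>x M\<^sup>2 / 2 + 5 \<eta>\<^sub>y B\<^sup>2 / 2)\<close> plus a noise term of mean zero.
  Quadratic growth of \<open>P\<close> around \<open>x\<^sup>*\<close> and the Lipschitz bound on \<open>A\<close> turn the two distances into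
  multiples of the expected gaps at \<open>x\<close> and \<open>x'\<close>, and for the prescribed step sizes and \<open>T\<close> the
  expected gap is at least halved in every stage.
\<close>

section \<open>Samples independent of the past\<close>

text \<open>The sigma-algebra generated by the samples with index in \<open>J\<close>, as a pullback
  of the product sigma-algebra. It is used as a domain of measurability:
  \<open>f \<in> measurable (history W D Z J) N\<close> says that \<open>f\<close> is determined by
  these samples.\<close>

definition history :: "'w measure \<Rightarrow> 'c measure \<Rightarrow> ('i \<Rightarrow> 'w \<Rightarrow> 'c) \<Rightarrow> 'i set \<Rightarrow> 'w measure" where
  "history W D Z J = vimage_algebra (space W) (\<lambda>\<omega>. \<lambda>i\<in>J. Z i \<omega>) (PiM J (\<lambda>_. D))"

lemma space_history [simp]: "space (history W D Z J) = space W"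
  by (simp add: history_def)

lemma restrict_in_space_PiM:
  assumes "\<And>i. i \<in> J \<Longrightarrow> Z i \<in> measurable W D"
  shows "(\<lambda>\<omega>. \<lambda>i\<in>J. Z i \<omega>) \<in> space W \<rightarrow> space (PiM J (\<lambda>_. D))"
  using measurable_space[OF assms] by (auto simp: space_PiM)

lemma measurable_history_component:
  assumes "\<And>i. i \<in> J \<Longrightarrow> Z i \<in> measurable W D" "i \<in> J"
  shows "Z i \<in> measurable (history W D Z J) D"
proof -
  have "(\<lambda>\<omega>. \<lambda>i\<in>J. Z i \<omega>) \<in> measurable (history W D Z J) (PiM J (\<lambda>_. D))"
    unfolding history_def
    by (intro measurable_vimage_algebra1 restrict_in_space_PiM assms(1))
  from measurable_compose[OF this measurable_component_singleton[OF assms(2)]]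
  show ?thesis using assms(2) by simp
qed

lemma measurable_history_mono:
  assumes f: "f \<in> measurable (history W D Z J) N" and J: "J \<subseteq> J'"
    and Z: "\<And>i. i \<in> J' \<Longrightarrow> Z i \<in> measurable W D"
  shows "f \<in> measurable (history W D Z J') N"
proof -
  have "(\<lambda>\<omega>. \<omega>) \<in> measurable (history W D Z J') (history W D Z J)"
    unfolding history_def[of W D Z J]
  proof (rule measurable_vimage_algebra2)
    show "(\<lambda>\<omega>. \<lambda>i\<in>J. Z i \<omega>) \<in> measurable (history W D Z J') (PiM J (\<lambda>_. D))"
      using J by (intro measurable_restrict measurable_history_component Z) auto
  qed simp
  then show ?thesis using f by (rule measurable_compose)
qed

lemma measurable_historyD:
  assumes f: "f \<in> measurable (history W D Z J) N"
    and Z: "\<And>i. i \<in> J \<Longrightarrow> Z i \<in> measurable W D"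
  shows "f \<in> measurable W N"
proof -
  have "(\<lambda>\<omega>. \<omega>) \<in> measurable W (history W D Z J)"
    unfolding history_def
    by (rule measurable_vimage_algebra2) (auto intro!: measurable_restrict Z)
  then show ?thesis using f by (rule measurable_compose)
qed

text \<open>Preimages under \<open>S\<close> lie in the sigma-algebra generated by the samples in
  \<open>J\<close>, which is independent of the one generated by \<open>Z i\<close>. Hence
  probabilities of rectangles factor, and rectangles determine the product measure.\<close>

lemma (in prob_space) distr_history_pair:
  assumes ind: "indep_vars (\<lambda>_. D) Z I" and J: "J \<subseteq> I" "i \<in> I" "i \<notin> J"
    and S: "S \<in> measurable (history M D Z J) N"
  shows "distr M N S \<Otimes>\<^sub>M distr M D (Z i) = distr M (N \<Otimes>\<^sub>M D) (\<lambda>\<omega>. (S \<omega>, Z i \<omega>))"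
proof -
  have Z: "Z j \<in> measurable M D" if "j \<in> I" for j
    using ind that by (auto simp: indep_vars_def)
  let ?G = "sigma_sets (space M) {(\<lambda>\<omega>. \<lambda>i\<in>J. Z i \<omega>) -` A \<inter> space M |A. A \<in> sets (PiM J (\<lambda>_. D))}"
  let ?H = "sigma_sets (space M) {(\<lambda>\<omega>. \<lambda>i\<in>{i}. Z i \<omega>) -` A \<inter> space M |A. A \<in> sets (PiM {i} (\<lambda>_. D))}"
  have "indep_var (PiM J (\<lambda>_. D)) (\<lambda>\<omega>. \<lambda>i\<in>J. Z i \<omega>) (PiM {i} (\<lambda>_. D)) (\<lambda>\<omega>. \<lambda>i\<in>{i}. Z i \<omega>)"
    using J by (intro indep_var_restrict[OF ind]) auto
  then have GH: "indep_set ?G ?H"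
    unfolding indep_var_eq by blast
  have S': "random_variable N S" using J Z by (intro measurable_historyD[OF S]) auto
  have Zi: "random_variable D (Z i)" using Z J by auto
  interpret S: prob_space "distr M N S" using S' by (rule prob_space_distr)
  interpret Zi: prob_space "distr M D (Z i)" using Zi by (rule prob_space_distr)
  show ?thesis
  proof (rule pair_measure_eqI)
    fix A B assume "A \<in> sets (distr M N S)" "B \<in> sets (distr M D (Z i))"
    then have AB: "A \<in> sets N" "B \<in> sets D" by auto
    have "S -` A \<inter> space M \<in> ?G"
      using measurable_sets[OF S AB(1)] by (simp add: history_def sets_vimage_algebra)
    \<comment> \<open>Independence is available for restricted families, so \<open>Z i\<close> is
      read as the coordinate of a one-element family.\<close>
    moreover have "Z i -` B \<inter> space M =
        (\<lambda>\<omega>. \<lambda>i\<in>{i}. Z i \<omega>) -` ((\<lambda>p. p i) -` B \<inter> space (PiM {i} (\<lambda>_. D))) \<inter> space M"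
      using measurable_space[OF Zi] by (auto simp: space_PiM)
    then have "Z i -` B \<inter> space M \<in> ?H" if "(\<lambda>p. p i) -` B \<inter> space (PiM {i} (\<lambda>_. D)) \<in> sets (PiM {i} (\<lambda>_. D))"
      using that by (intro sigma_sets.Basic) blast
    moreover have "(\<lambda>p. p i) -` B \<inter> space (PiM {i} (\<lambda>_. D)) \<in> sets (PiM {i} (\<lambda>_. D))"
      using AB(2) by measurable
    ultimately have "prob ((S -` A \<inter> space M) \<inter> (Z i -` B \<inter> space M))
        = prob (S -` A \<inter> space M) * prob (Z i -` B \<inter> space M)"
      by (intro indep_setD[OF GH]) blast+
    moreover have "(\<lambda>\<omega>. (S \<omega>, Z i \<omega>)) -` (A \<times> B) \<inter> space M = (S -` A \<inter> space M) \<inter> (Z i -` B \<inter> space M)"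
      by auto
    ultimately show "emeasure (distr M N S) A * emeasure (distr M D (Z i)) B =
        emeasure (distr M (N \<Otimes>\<^sub>M D) (\<lambda>\<omega>. (S \<omega>, Z i \<omega>))) (A \<times> B)"
      using AB S' Zi by (simp add: emeasure_distr emeasure_eq_measure ennreal_mult'')
  qed (unfold_locales, simp_all cong: sets_pair_measure_cong)
qed

text \<open>Takes the place of conditional expectation: the joint law of past state and fresh sample
  is a product measure, so Fubini integrates over the sample first, with the state frozen.\<close>

lemma (in prob_space) integral_fresh_sample_eq_0:
  fixes h :: "'s \<times> 'c \<Rightarrow> real" and D :: "'c measure"
  assumes ind: "indep_vars (\<lambda>_. D) Z I" and J: "J \<subseteq> I" "i \<in> I" "i \<notin> J"
    and S: "S \<in> measurable (history M D Z J) N" and distr: "distr M D (Z i) = D"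
    and h: "h \<in> borel_measurable (N \<Otimes>\<^sub>M D)"
    and int: "integrable M (\<lambda>\<omega>. h (S \<omega>, Z i \<omega>))"
    and zero: "\<And>s. s \<in> space N \<Longrightarrow> (\<integral>z. h (s, z) \<partial>D) = 0"
  shows "(\<integral>\<omega>. h (S \<omega>, Z i \<omega>) \<partial>M) = 0"
proof -
  have Z: "random_variable D (Z j)" if "j \<in> I" for j
    using ind that by (auto simp: indep_vars_def)
  have S': "random_variable N S"
    using J Z by (intro measurable_historyD[OF S]) auto
  let ?S = "distr M N S"
  have eq: "?S \<Otimes>\<^sub>M D = distr M (N \<Otimes>\<^sub>M D) (\<lambda>\<omega>. (S \<omega>, Z i \<omega>))"
    using distr_history_pair[OF ind J S] distr by simp
  interpret S: prob_space ?S using S' by (rule prob_space_distr)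
  interpret D: prob_space D using prob_space_distr[OF Z[OF J(2)]] distr by simp
  interpret SD: pair_prob_space ?S D ..
  have SZ: "random_variable (N \<Otimes>\<^sub>M D) (\<lambda>\<omega>. (S \<omega>, Z i \<omega>))"
    using S' Z[OF J(2)] by (rule measurable_Pair)
  have "integrable (?S \<Otimes>\<^sub>M D) h"
    unfolding eq using int by (subst integrable_distr_eq[OF SZ h])
  then have "(\<integral>s. (\<integral>z. h (s, z) \<partial>D) \<partial>?S) = (\<integral>p. h p \<partial>(?S \<Otimes>\<^sub>M D))"
    by (rule SD.integral_fst')
  also have "\<dots> = (\<integral>\<omega>. h (S \<omega>, Z i \<omega>) \<partial>M)"
    unfolding eq by (rule integral_distr[OF SZ h])
  also have "(\<integral>s. (\<integral>z. h (s, z) \<partial>D) \<partial>?S) = (\<integral>s. 0 \<partial>?S)"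
    using zero by (intro Bochner_Integration.integral_cong) auto
  finally show ?thesis by simp
qed

section \<open>Projected subgradient steps\<close>

lemma measurable_closest_point:
  fixes S :: "'e::euclidean_space set"
  assumes "closed S" "convex S" "S \<noteq> {}"
  shows "closest_point S \<in> measurable borel (restrict_space borel S)"
  using assms continuous_on_closest_point[of S UNIV]
  by (intro measurable_restrict_space2 borel_measurable_continuous_onI)
    (auto intro: closest_point_in_set)

lemma measurable_restrict_spaceD: "h \<in> measurable N (restrict_space V S) \<Longrightarrow> h \<in> measurable N V"
  by (simp add: measurable_restrict_space2_iff)

lemma norm_closest_point_diff_le:
  fixes u :: "'a::euclidean_space"
  assumes "convex S" "closed S" "u \<in> S"
  shows "norm (closest_point S z - u) \<le> norm (z - u)"
  using closest_point_lipschitz[of S z u] closest_point_self[of u S] assms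
  by (auto simp: dist_norm)

text \<open>Expanding the square of the distance to \<open>u\<close> bounds each inner product by a
  difference of consecutive distances plus \<open>e * C\<^sup>2 / 2\<close>, and the differences
  telescope. The map \<open>pr\<close> merely has to bring points no farther from \<open>u\<close>,
  which covers projections and the identity; the directions \<open>v\<close> are arbitrary, which
  covers ascent steps and noise.\<close>

lemma sum_inner_subgradient_steps:
  fixes p v :: "nat \<Rightarrow> 'a::real_inner"
  assumes pr: "\<And>z. norm (pr z - u) \<le> norm (z - u)"
    and step: "\<And>t. t < T \<Longrightarrow> p (Suc t) = pr (p t - e *\<^sub>R v t)"
    and v: "\<And>t. t < T \<Longrightarrow> norm (v t) \<le> C" and e: "e > 0"
  shows "(\<Sum>t<T. v t \<bullet> (p t - u)) \<le> (norm (p 0 - u))\<^sup>2 / (2 * e) + e * C\<^sup>2 / 2 * T"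
proof -
  have one: "v t \<bullet> (p t - u) \<le> (norm (p t - u))\<^sup>2 / (2 * e) - (norm (p (Suc t) - u))\<^sup>2 / (2 * e) + e * C\<^sup>2 / 2"
    if t: "t < T" for t
  proof -
    have "(norm (p (Suc t) - u))\<^sup>2 \<le> (norm ((p t - u) - e *\<^sub>R v t))\<^sup>2"
      using pr[of "p t - e *\<^sub>R v t"] step[OF t] by (intro power_mono) (auto simp: algebra_simps)
    also have "\<dots> = (norm (p t - u))\<^sup>2 - 2 * e * (v t \<bullet> (p t - u)) + e\<^sup>2 * (norm (v t))\<^sup>2"
      unfolding power2_norm_eq_inner by (simp add: inner_diff inner_commute power2_eq_square algebra_simps)
    also have "\<dots> \<le> (norm (p t - u))\<^sup>2 - 2 * e * (v t \<bullet> (p t - u)) + e\<^sup>2 * C\<^sup>2"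
      using v[OF t] by (intro add_left_mono mult_left_mono power_mono) auto
    finally show ?thesis using e by (simp add: field_simps power2_eq_square)
  qed
  have "(\<Sum>t<T. v t \<bullet> (p t - u)) \<le>
      (\<Sum>t<T. (norm (p t - u))\<^sup>2 / (2 * e) - (norm (p (Suc t) - u))\<^sup>2 / (2 * e) + e * C\<^sup>2 / 2)"
    by (rule sum_mono) (use one in auto)
  also have "\<dots> = (norm (p 0 - u))\<^sup>2 / (2 * e) - (norm (p T - u))\<^sup>2 / (2 * e) + e * C\<^sup>2 / 2 * T"
    unfolding sum.distrib sum_lessThan_telescope'[of "\<lambda>t. (norm (p t - u))\<^sup>2 / (2 * e)"] by simp
  also have "\<dots> \<le> (norm (p 0 - u))\<^sup>2 / (2 * e) + e * C\<^sup>2 / 2 * T"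
    using e by simp
  finally show ?thesis .
qed

section \<open>Bounded stochastic subgradients and their means\<close>

locale saddle_oracle = prob_space D
  for D :: "'c measure" +
  fixes X :: "'a::euclidean_space set" and Y :: "'b::euclidean_space set"
    and f :: "'a \<Rightarrow> 'b \<Rightarrow> real"
    and Gx :: "'a \<Rightarrow> 'b \<Rightarrow> 'c \<Rightarrow> 'a" and Gy :: "'a \<Rightarrow> 'b \<Rightarrow> 'c \<Rightarrow> 'b"
    and B\<^sub>x B\<^sub>y :: real
  assumes Gx_measurable: "(\<lambda>(x, y, z). Gx x y z) \<in>
        borel_measurable (restrict_space borel X \<Otimes>\<^sub>M restrict_space borel Y \<Otimes>\<^sub>M D)"
    and Gy_measurable: "(\<lambda>(x, y, z). Gy x y z) \<in>
        borel_measurable (restrict_space borel X \<Otimes>\<^sub>M restrict_space borel Y \<Otimes>\<^sub>M D)"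
    and Gx_unbiased: "\<And>x y. x \<in> X \<Longrightarrow> y \<in> Y \<Longrightarrow>
        (\<integral>z. Gx x y z \<partial>D) \<in> subgradients X (\<lambda>x'. f x' y) x"
    and Gy_unbiased: "\<And>x y. x \<in> X \<Longrightarrow> y \<in> Y \<Longrightarrow>
        (\<integral>z. Gy x y z \<partial>D) \<in> supergradients Y (\<lambda>y'. f x y') y"
    and Gx_bound: "\<And>x y z. x \<in> X \<Longrightarrow> y \<in> Y \<Longrightarrow> z \<in> space D \<Longrightarrow> norm (Gx x y z) \<le> B\<^sub>x"
    and Gy_bound: "\<And>x y z. x \<in> X \<Longrightarrow> y \<in> Y \<Longrightarrow> z \<in> space D \<Longrightarrow> norm (Gy x y z) \<le> B\<^sub>y"
begin

definition dx :: "'a \<Rightarrow> 'b \<Rightarrow> 'a" where "dx x y = (\<integral>z. Gx x y z \<partial>D)"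
definition dy :: "'a \<Rightarrow> 'b \<Rightarrow> 'b" where "dy x y = (\<integral>z. Gy x y z \<partial>D)"

lemma dx_subgradient: "x \<in> X \<Longrightarrow> y \<in> Y \<Longrightarrow> x' \<in> X \<Longrightarrow> f x y + dx x y \<bullet> (x' - x) \<le> f x' y"
  using Gx_unbiased[of x y] by (auto simp: dx_def subgradients_def)

lemma dy_supergradient: "x \<in> X \<Longrightarrow> y \<in> Y \<Longrightarrow> y' \<in> Y \<Longrightarrow> f x y' \<le> f x y + dy x y \<bullet> (y' - y)"
  using Gy_unbiased[of x y] by (auto simp: dy_def supergradients_def)

lemma G_integrable:
  assumes "x \<in> X" "y \<in> Y"
  shows Gx_integrable: "integrable D (Gx x y)" and Gy_integrable: "integrable D (Gy x y)"
proof -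
  have p: "(\<lambda>z. (x, y, z)) \<in> measurable D (restrict_space borel X \<Otimes>\<^sub>M restrict_space borel Y \<Otimes>\<^sub>M D)"
    using assms by (intro measurable_Pair measurable_const measurable_ident_sets refl) (auto simp: space_restrict_space)
  show "integrable D (Gx x y)"
    using measurable_compose[OF p Gx_measurable] Gx_bound[OF assms]
    by (intro integrable_const_bound[where B=B\<^sub>x]) (auto intro!: AE_I2)
  show "integrable D (Gy x y)"
    using measurable_compose[OF p Gy_measurable] Gy_bound[OF assms]
    by (intro integrable_const_bound[where B=B\<^sub>y]) (auto intro!: AE_I2)
qed

lemma norm_dx_le:
  assumes "x \<in> X" "y \<in> Y" shows "norm (dx x y) \<le> B\<^sub>x"
proof -
  have "norm (dx x y) \<le> (\<integral>z. norm (Gx x y z) \<partial>D)"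
    unfolding dx_def by (rule integral_norm_bound)
  also have "\<dots> \<le> B\<^sub>x"
    using Gx_integrable[OF assms] Gx_bound[OF assms] by (intro integral_le_const) (auto intro!: AE_I2)
  finally show ?thesis .
qed

lemma norm_dy_le:
  assumes "x \<in> X" "y \<in> Y" shows "norm (dy x y) \<le> B\<^sub>y"
proof -
  have "norm (dy x y) \<le> (\<integral>z. norm (Gy x y z) \<partial>D)"
    unfolding dy_def by (rule integral_norm_bound)
  also have "\<dots> \<le> B\<^sub>y"
    using Gy_integrable[OF assms] Gy_bound[OF assms] by (intro integral_le_const) (auto intro!: AE_I2)
  finally show ?thesis .
qed

lemma measurable_Gx [measurable (raw)]:
  assumes "a \<in> measurable N (restrict_space borel X)" "b \<in> measurable N (restrict_space borel Y)"
    "c \<in> measurable N D"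
  shows "(\<lambda>\<omega>. Gx (a \<omega>) (b \<omega>) (c \<omega>)) \<in> borel_measurable N"
  using measurable_compose[OF measurable_Pair[OF assms(1) measurable_Pair[OF assms(2,3)]] Gx_measurable]
  by simp

lemma measurable_Gy [measurable (raw)]:
  assumes "a \<in> measurable N (restrict_space borel X)" "b \<in> measurable N (restrict_space borel Y)"
    "c \<in> measurable N D"
  shows "(\<lambda>\<omega>. Gy (a \<omega>) (b \<omega>) (c \<omega>)) \<in> borel_measurable N"
  using measurable_compose[OF measurable_Pair[OF assms(1) measurable_Pair[OF assms(2,3)]] Gy_measurable]
  by simp

lemma measurable_dx [measurable (raw)]:
  assumes [measurable]: "a \<in> measurable N (restrict_space borel X)" "b \<in> measurable N (restrict_space borel Y)"
  shows "(\<lambda>\<omega>. dx (a \<omega>) (b \<omega>)) \<in> borel_measurable N"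
  unfolding dx_def by measurable

lemma measurable_dy [measurable (raw)]:
  assumes [measurable]: "a \<in> measurable N (restrict_space borel X)" "b \<in> measurable N (restrict_space borel Y)"
  shows "(\<lambda>\<omega>. dy (a \<omega>) (b \<omega>)) \<in> borel_measurable N"
  unfolding dy_def by measurable

end

text \<open>Collects what the analysis of the stages uses. Boundedness of \<open>X\<close> and
  \<open>Y\<close>, continuity of \<open>P\<close> and the Lipschitz property of \<open>A\<close>
  are derived from the original hypotheses at the end; there \<open>K\<close> becomes
  \<open>L * G\<close>, and \<open>growth\<close> expresses strong convexity of \<open>P\<close> at
  its minimizer.\<close>

locale spd_problem = saddle_oracle D X Y f Gx Gy B\<^sub>x B\<^sub>y
  for D :: "'c measure" and X :: "'a::euclidean_space set" and Y :: "'b::euclidean_space set"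
    and f Gx Gy B\<^sub>x B\<^sub>y +
  fixes P :: "'a \<Rightarrow> real" and A :: "'a \<Rightarrow> 'b" and K \<mu> :: real and xopt :: 'a
  assumes X: "closed X" "convex X" "bounded X" and Y: "closed Y" "convex Y" "bounded Y"
    and P_le: "\<And>x y. x \<in> X \<Longrightarrow> y \<in> Y \<Longrightarrow> f x y \<le> P x"
    and P_eq: "\<And>x. x \<in> X \<Longrightarrow> P x = f x (A x)"
    and P_continuous: "continuous_on X P"
    and A_in: "\<And>x. x \<in> X \<Longrightarrow> A x \<in> Y"
    and A_lipschitz: "K-lipschitz_on X A"
    and minimizer: "xopt \<in> X"
    and growth: "\<And>x. x \<in> X \<Longrightarrow> \<mu> / 2 * (norm (x - xopt))\<^sup>2 \<le> P x - P xopt"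
    and \<mu>_pos: "\<mu> > 0"

context spd_problem
begin

lemma measurable_A [measurable]: "A \<in> measurable (restrict_space borel X) (restrict_space borel Y)"
  using A_in lipschitz_on_continuous_on[OF A_lipschitz]
  by (intro measurable_restrict_space2 borel_measurable_continuous_on_restrict)
    (auto simp: space_restrict_space)

lemma measurable_P [measurable]: "P \<in> borel_measurable (restrict_space borel X)"
  by (intro borel_measurable_continuous_on_restrict P_continuous)

lemma integrable_gap:
  assumes W: "prob_space W" and v: "v \<in> measurable W (restrict_space borel X)"
  shows "integrable W (\<lambda>\<omega>. P (v \<omega>) - P xopt)"
proof -
  interpret W: prob_space W by fact
  have "bounded (P ` X)"
    using X by (intro compact_imp_bounded compact_continuous_image P_continuous)
      (simp add: compact_eq_bounded_closed)
  then obtain c where c: "\<And>x. x \<in> X \<Longrightarrow> norm (P x) \<le> c"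
    unfolding bounded_iff by blast
  have "integrable W (\<lambda>\<omega>. P (v \<omega>))"
    using measurable_compose[OF v measurable_P] measurable_space[OF v] c
    by (intro W.integrable_const_bound[where B=c]) (auto intro!: AE_I2 simp: space_restrict_space)
  then show ?thesis by simp
qed

end

section \<open>One stage with fixed step sizes\<close>

locale spd_steps = spd_problem D X Y f Gx Gy B\<^sub>x B\<^sub>y P A K \<mu> xopt
  for D :: "'c measure" and X :: "'a::euclidean_space set" and Y :: "'b::euclidean_space set"
    and f Gx Gy B\<^sub>x B\<^sub>y P A K \<mu> xopt +
  fixes \<eta>\<^sub>x \<eta>\<^sub>y :: real and T :: nat
  assumes \<eta>_pos: "\<eta>\<^sub>x > 0" "\<eta>\<^sub>y > 0" and T_pos: "T > 0"
begin

definition primal :: "'a \<Rightarrow> (nat \<Rightarrow> 'c) \<Rightarrow> nat \<Rightarrow> 'a" where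
  "primal x z t = fst (spd_iter X Y Gx Gy \<eta>\<^sub>x \<eta>\<^sub>y (x, A x) z t)"

definition dual :: "'a \<Rightarrow> (nat \<Rightarrow> 'c) \<Rightarrow> nat \<Rightarrow> 'b" where
  "dual x z t = snd (spd_iter X Y Gx Gy \<eta>\<^sub>x \<eta>\<^sub>y (x, A x) z t)"

definition dual_error :: "'a \<Rightarrow> (nat \<Rightarrow> 'c) \<Rightarrow> nat \<Rightarrow> 'b" where
  "dual_error x z t = dy (primal x z t) (dual x z t) - Gy (primal x z t) (dual x z t) (z t)"

text \<open>The comparison point \<open>A (average x z)\<close> depends on the samples, so the dual noise is not
  centred against it. Unprojected gradient steps along the dual error give points \<open>shadow x z t\<close>
  that depend on the past only and whose regret against any point is controlled; the remaining noise
  \<open>step_noise\<close> has conditional mean zero.\<close>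

definition shadow :: "'a \<Rightarrow> (nat \<Rightarrow> 'c) \<Rightarrow> nat \<Rightarrow> 'b" where
  "shadow x z t = A x + \<eta>\<^sub>y *\<^sub>R (\<Sum>k<t. dual_error x z k)"

definition step_noise :: "('a \<times> 'b \<times> 'b) \<times> 'c \<Rightarrow> real" where
  "step_noise = (\<lambda>((x, y, u), z). (dx x y - Gx x y z) \<bullet> (x - xopt) + (dy x y - Gy x y z) \<bullet> (u - y))"

definition average :: "'a \<Rightarrow> (nat \<Rightarrow> 'c) \<Rightarrow> 'a" where
  "average x z = (1 / real T) *\<^sub>R (\<Sum>t<T. primal x z t)"

lemma primal_0 [simp]: "primal x z 0 = x" and dual_0 [simp]: "dual x z 0 = A x"
  and shadow_0 [simp]: "shadow x z 0 = A x"
  by (simp_all add: primal_def dual_def shadow_def)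

lemma primal_Suc:
  "primal x z (Suc t) = closest_point X (primal x z t - \<eta>\<^sub>x *\<^sub>R Gx (primal x z t) (dual x z t) (z t))"
  and dual_Suc:
  "dual x z (Suc t) = closest_point Y (dual x z t + \<eta>\<^sub>y *\<^sub>R Gy (primal x z t) (dual x z t) (z t))"
  and shadow_Suc: "shadow x z (Suc t) = shadow x z t + \<eta>\<^sub>y *\<^sub>R dual_error x z t"
  by (auto simp: primal_def dual_def shadow_def split_beta Let_def algebra_simps)

lemma primal_in: "x \<in> X \<Longrightarrow> primal x z t \<in> X"
  by (cases t) (use X in \<open>auto simp: primal_Suc intro!: closest_point_in_set\<close>)

lemma dual_in: "x \<in> X \<Longrightarrow> dual x z t \<in> Y"
  by (cases t) (use Y in \<open>auto simp: dual_Suc A_in intro!: closest_point_in_set dest: A_in\<close>)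

lemma average_in: "x \<in> X \<Longrightarrow> average x z \<in> X"
  unfolding average_def scaleR_sum_right
  using T_pos by (intro convex_sum X primal_in) auto

lemma norm_dual_error_le:
  assumes "x \<in> X" "z t \<in> space D"
  shows "norm (dual_error x z t) \<le> 2 * B\<^sub>y"
  using norm_triangle_ineq4[of "dy (primal x z t) (dual x z t)" "Gy (primal x z t) (dual x z t) (z t)"]
    norm_dy_le[OF primal_in dual_in, of x x z t z t] Gy_bound[OF primal_in dual_in, of x x "z t" z t z t] assms
  unfolding dual_error_def by auto

text \<open>The shadow sequence is not projected and may leave \<open>Y\<close>, so boundedness of
  \<open>Y\<close> does not control it. This bound is what makes the noise bounded and hence
  integrable.\<close>

lemma norm_shadow_diff_le:
  assumes "x \<in> X" "\<And>k. k < t \<Longrightarrow> z k \<in> space D"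
  shows "norm (shadow x z t - A x) \<le> 2 * \<eta>\<^sub>y * B\<^sub>y * t"
proof -
  have "norm (\<Sum>k<t. dual_error x z k) \<le> (\<Sum>k<t. 2 * B\<^sub>y)"
    using assms by (intro sum_norm_le norm_dual_error_le) auto
  then show ?thesis using \<eta>_pos by (simp add: shadow_def mult.commute mult.left_commute)
qed

text \<open>A bound for every realization of the samples. It adds three regrets: primal steps
  against \<open>xopt\<close>, dual steps against \<open>A (average x z)\<close>, and shadow steps
  against the same point. What the regrets leave over is \<open>step_noise\<close>.\<close>

lemma average_gap_le:
  assumes x: "x \<in> X" and z: "\<And>t. t < T \<Longrightarrow> z t \<in> space D"
  shows "real T * (P (average x z) - P xopt) \<le>
    (norm (x - xopt))\<^sup>2 / (2 * \<eta>\<^sub>x) + (norm (A x - A (average x z)))\<^sup>2 / \<eta>\<^sub>y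
    + real T * (\<eta>\<^sub>x * B\<^sub>x\<^sup>2 / 2 + 5 * \<eta>\<^sub>y * B\<^sub>y\<^sup>2 / 2)
    + (\<Sum>t<T. step_noise ((primal x z t, dual x z t, shadow x z t), z t))"
proof -
  define xb where "xb = average x z"
  define yb where "yb = A xb"
  let ?x = "primal x z" and ?y = "dual x z" and ?u = "shadow x z" and ?w = "dual_error x z"
  let ?gx = "\<lambda>t. Gx (?x t) (?y t) (z t)" and ?gy = "\<lambda>t. Gy (?x t) (?y t) (z t)"
  let ?n = "\<lambda>t. step_noise ((?x t, ?y t, ?u t), z t)"
  note xi = primal_in[OF x] and yi = dual_in[OF x]
  have xb: "xb \<in> X" and yb: "yb \<in> Y" using average_in[OF x] A_in by (auto simp: xb_def yb_def)
  \<comment> \<open>The dual and shadow sequences both start at \<open>A x\<close>, so their initial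
    distances to \<open>yb\<close> agree and the two halves merge.\<close>
  have half: "q / (2 * \<eta>\<^sub>y) + q / (2 * \<eta>\<^sub>y) = q / \<eta>\<^sub>y" for q
    using \<eta>_pos by (simp add: field_simps)
  have sum_x: "(\<Sum>t<T. ?x t) = real T *\<^sub>R xb"
    using T_pos by (simp add: xb_def average_def)
  \<comment> \<open>Jensen's inequality by hand: the affine minorant of \<open>f\<close> at
    \<open>xb\<close> for fixed \<open>yb\<close> is summed over the iterates, and its linear parts
    cancel because \<open>xb\<close> is their mean.\<close>
  have "(\<Sum>t<T. P xb + dx xb yb \<bullet> (?x t - xb)) = real T * P xb + dx xb yb \<bullet> (\<Sum>t<T. ?x t - xb)"
    by (simp add: sum.distrib inner_sum_right)
  also have "(\<Sum>t<T. ?x t - xb) = 0" by (simp add: sum_subtractf sum_x sum_constant_scaleR)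
  finally have "real T * P xb = (\<Sum>t<T. P xb + dx xb yb \<bullet> (?x t - xb))" by simp
  also have "\<dots> \<le> (\<Sum>t<T. f (?x t) yb)"
    using dx_subgradient[OF xb yb xi] P_eq[OF xb] by (intro sum_mono) (auto simp: yb_def)
  finally have "real T * (P xb - P xopt) \<le> (\<Sum>t<T. f (?x t) yb - P xopt)"
    by (simp add: sum_subtractf algebra_simps)
  also have "\<dots> \<le> (\<Sum>t<T. ?gx t \<bullet> (?x t - xopt) + (- ?gy t) \<bullet> (?y t - yb) + (- ?w t) \<bullet> (?u t - yb) + ?n t)"
  proof (rule sum_mono)
    fix t assume "t \<in> {..<T}"
    have "f (?x t) yb \<le> f (?x t) (?y t) + dy (?x t) (?y t) \<bullet> (yb - ?y t)"
      by (rule dy_supergradient[OF xi yi yb])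
    moreover have "f (?x t) (?y t) + dx (?x t) (?y t) \<bullet> (xopt - ?x t) \<le> f xopt (?y t)"
      by (rule dx_subgradient[OF xi yi minimizer])
    moreover have "f xopt (?y t) \<le> P xopt" by (rule P_le[OF minimizer yi])
    \<comment> \<open>With \<open>w\<close> the dual error, the mean direction is the sampled one
      plus \<open>w\<close>, and \<open>w \<bullet> (yb - y)\<close> splits at the shadow point into
      \<open>- w \<bullet> (u - yb)\<close> and \<open>w \<bullet> (u - y)\<close>. The second part
      no longer involves \<open>yb\<close> and goes into the noise.\<close>
    ultimately show "f (?x t) yb - P xopt \<le> ?gx t \<bullet> (?x t - xopt) + (- ?gy t) \<bullet> (?y t - yb) + (- ?w t) \<bullet> (?u t - yb) + ?n t"
      by (simp add: step_noise_def dual_error_def inner_diff_left inner_diff_right)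
  qed
  also have "\<dots> = (\<Sum>t<T. ?gx t \<bullet> (?x t - xopt)) + (\<Sum>t<T. (- ?gy t) \<bullet> (?y t - yb))
      + (\<Sum>t<T. (- ?w t) \<bullet> (?u t - yb)) + (\<Sum>t<T. ?n t)"
    by (simp only: sum.distrib)
  also have "(\<Sum>t<T. ?gx t \<bullet> (?x t - xopt)) \<le> (norm (?x 0 - xopt))\<^sup>2 / (2 * \<eta>\<^sub>x) + \<eta>\<^sub>x * B\<^sub>x\<^sup>2 / 2 * T"
    using X minimizer z by (intro sum_inner_subgradient_steps[where pr="closest_point X"])
      (auto simp: primal_Suc xi yi \<eta>_pos intro: norm_closest_point_diff_le Gx_bound)
  also have "(\<Sum>t<T. (- ?gy t) \<bullet> (?y t - yb)) \<le> (norm (?y 0 - yb))\<^sup>2 / (2 * \<eta>\<^sub>y) + \<eta>\<^sub>y * B\<^sub>y\<^sup>2 / 2 * T"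
    using Y yb z by (intro sum_inner_subgradient_steps[where pr="closest_point Y"])
      (auto simp: dual_Suc xi yi \<eta>_pos intro: norm_closest_point_diff_le Gy_bound)
  \<comment> \<open>The dual error is bounded by \<open>2 * B\<^sub>y\<close>, so this regret
    contributes four times the quadratic term of the dual steps; together they give the factor
    5.\<close>
  also have "(\<Sum>t<T. (- ?w t) \<bullet> (?u t - yb)) \<le> (norm (?u 0 - yb))\<^sup>2 / (2 * \<eta>\<^sub>y) + \<eta>\<^sub>y * (2 * B\<^sub>y)\<^sup>2 / 2 * T"
    by (intro sum_inner_subgradient_steps[where pr="\<lambda>u. u"])
      (use norm_dual_error_le[OF x z] in \<open>auto simp: shadow_Suc \<eta>_pos\<close>)
  finally show ?thesis
    using half[of "(norm (A x - yb))\<^sup>2"]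
    unfolding xb_def[symmetric] yb_def[symmetric] by (simp add: algebra_simps)
qed

text \<open>Quadratic growth bounds squared distances to \<open>xopt\<close> by gaps; the dual
  distance is first reduced to a primal one by the Lipschitz property of \<open>A\<close>. The gap
  of the average now stands on both sides and is absorbed later, when \<open>T\<close> is large
  enough.\<close>

lemma average_gap_le_growth:
  assumes x: "x \<in> X" and z: "\<And>t. t < T \<Longrightarrow> z t \<in> space D"
  shows "real T * (P (average x z) - P xopt) \<le>
    (P x - P xopt) / (\<mu> * \<eta>\<^sub>x)
    + 4 * K\<^sup>2 / (\<mu> * \<eta>\<^sub>y) * ((P x - P xopt) + (P (average x z) - P xopt))
    + real T * (\<eta>\<^sub>x * B\<^sub>x\<^sup>2 / 2 + 5 * \<eta>\<^sub>y * B\<^sub>y\<^sup>2 / 2)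
    + (\<Sum>t<T. step_noise ((primal x z t, dual x z t, shadow x z t), z t))"
proof -
  define xb where "xb = average x z"
  have xb: "xb \<in> X" using average_in[OF x] by (simp add: xb_def)
  have dist_sq: "(norm (v - xopt))\<^sup>2 \<le> 2 / \<mu> * (P v - P xopt)" if "v \<in> X" for v
    using growth[OF that] \<mu>_pos by (simp add: field_simps)
  have "(norm (x - xopt))\<^sup>2 / (2 * \<eta>\<^sub>x) \<le> (2 / \<mu> * (P x - P xopt)) / (2 * \<eta>\<^sub>x)"
    using \<eta>_pos dist_sq[OF x] by (intro divide_right_mono) auto
  also have "\<dots> = (P x - P xopt) / (\<mu> * \<eta>\<^sub>x)" using \<mu>_pos \<eta>_pos by (simp add: divide_simps)
  finally have 1: "(norm (x - xopt))\<^sup>2 / (2 * \<eta>\<^sub>x) \<le> (P x - P xopt) / (\<mu> * \<eta>\<^sub>x)" .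
  \<comment> \<open>The parallelogram law, used to compare \<open>x\<close> and \<open>xb\<close>
    through \<open>xopt\<close>.\<close>
  have "(norm (x - xb))\<^sup>2 + (norm ((x - xopt) + (xb - xopt)))\<^sup>2 = 2 * (norm (x - xopt))\<^sup>2 + 2 * (norm (xb - xopt))\<^sup>2"
    unfolding power2_norm_eq_inner by (simp add: inner_diff inner_add inner_commute algebra_simps)
  then have "(norm (x - xb))\<^sup>2 \<le> 2 * (norm (x - xopt))\<^sup>2 + 2 * (norm (xb - xopt))\<^sup>2"
    using zero_le_power2[of "norm ((x - xopt) + (xb - xopt))"] by linarith
  also have "\<dots> \<le> 2 * (2 / \<mu> * (P x - P xopt)) + 2 * (2 / \<mu> * (P xb - P xopt))"
    by (intro add_mono mult_left_mono dist_sq x xb) auto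
  also have "\<dots> = 4 / \<mu> * ((P x - P xopt) + (P xb - P xopt))"
    using \<mu>_pos by (simp add: field_simps)
  finally have sq: "(norm (x - xb))\<^sup>2 \<le> 4 / \<mu> * ((P x - P xopt) + (P xb - P xopt))" .
  have "(norm (A x - A xb))\<^sup>2 \<le> (K * norm (x - xb))\<^sup>2"
    using lipschitz_onD[OF A_lipschitz x xb] by (intro power_mono) (auto simp: dist_norm)
  also have "\<dots> \<le> K\<^sup>2 * (4 / \<mu> * ((P x - P xopt) + (P xb - P xopt)))"
    unfolding power_mult_distrib by (intro mult_left_mono sq) auto
  finally have "(norm (A x - A xb))\<^sup>2 / \<eta>\<^sub>y \<le> K\<^sup>2 * (4 / \<mu> * ((P x - P xopt) + (P xb - P xopt))) / \<eta>\<^sub>y"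
    using \<eta>_pos by (intro divide_right_mono) auto
  also have "\<dots> = 4 * K\<^sup>2 / (\<mu> * \<eta>\<^sub>y) * ((P x - P xopt) + (P xb - P xopt))" by simp
  finally show ?thesis
    using 1 average_gap_le[where z=z, OF x z] unfolding xb_def by linarith
qed

text \<open>The space \<open>V\<close> is left open so that it can be a history: since samples
  before step \<open>t\<close> suffice, the iterates at \<open>t\<close> depend on the past
  alone.\<close>

lemma measurable_iterates:
  assumes x: "x \<in> measurable V (restrict_space borel X)"
    and z: "\<And>k. k < t \<Longrightarrow> z k \<in> measurable V D"
  shows "(\<lambda>\<omega>. primal (x \<omega>) (\<lambda>k. z k \<omega>) t) \<in> measurable V (restrict_space borel X)"
    and "(\<lambda>\<omega>. dual (x \<omega>) (\<lambda>k. z k \<omega>) t) \<in> measurable V (restrict_space borel Y)"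
proof -
  have "(\<lambda>\<omega>. primal (x \<omega>) (\<lambda>k. z k \<omega>) t) \<in> measurable V (restrict_space borel X) \<and>
    (\<lambda>\<omega>. dual (x \<omega>) (\<lambda>k. z k \<omega>) t) \<in> measurable V (restrict_space borel Y)"
    using z
  proof (induction t)
    case 0
    then show ?case using x measurable_compose[OF x measurable_A] by simp
  next
    case (Suc t)
    let ?p = "\<lambda>\<omega>. primal (x \<omega>) (\<lambda>k. z k \<omega>) t" and ?d = "\<lambda>\<omega>. dual (x \<omega>) (\<lambda>k. z k \<omega>) t"
    have [measurable]: "?p \<in> measurable V (restrict_space borel X)" "?d \<in> measurable V (restrict_space borel Y)"
      "z t \<in> measurable V D"
      using Suc by auto
    have p: "?p \<in> borel_measurable V" and d: "?d \<in> borel_measurable V"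
      by (rule measurable_restrict_spaceD; measurable)+
    have "(\<lambda>\<omega>. ?p \<omega> - \<eta>\<^sub>x *\<^sub>R Gx (?p \<omega>) (?d \<omega>) (z t \<omega>)) \<in> borel_measurable V"
      by (intro borel_measurable_diff p borel_measurable_scaleR measurable_const measurable_Gx) measurable
    moreover have "(\<lambda>\<omega>. ?d \<omega> + \<eta>\<^sub>y *\<^sub>R Gy (?p \<omega>) (?d \<omega>) (z t \<omega>)) \<in> borel_measurable V"
      by (intro borel_measurable_add d borel_measurable_scaleR measurable_const measurable_Gy) measurable
    moreover have "X \<noteq> {}" "Y \<noteq> {}" using minimizer A_in by auto
    ultimately show ?case
      unfolding primal_Suc dual_Suc
      using X Y by (intro conjI measurable_compose[OF _ measurable_closest_point]) auto
  qed
  then show "(\<lambda>\<omega>. primal (x \<omega>) (\<lambda>k. z k \<omega>) t) \<in> measurable V (restrict_space borel X)"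
    and "(\<lambda>\<omega>. dual (x \<omega>) (\<lambda>k. z k \<omega>) t) \<in> measurable V (restrict_space borel Y)" by auto
qed

lemma measurable_shadow:
  assumes x: "x \<in> measurable V (restrict_space borel X)"
    and z: "\<And>k. k < t \<Longrightarrow> z k \<in> measurable V D"
  shows "(\<lambda>\<omega>. shadow (x \<omega>) (\<lambda>k. z k \<omega>) t) \<in> borel_measurable V"
proof -
  have A: "(\<lambda>\<omega>. A (x \<omega>)) \<in> borel_measurable V"
    using measurable_compose[OF x measurable_A] by (simp add: measurable_restrict_space2_iff)
  have "(\<lambda>\<omega>. dual_error (x \<omega>) (\<lambda>k. z k \<omega>) k) \<in> borel_measurable V" if "k < t" for k
    unfolding dual_error_def
    using that z by (intro borel_measurable_diff measurable_dy measurable_Gy measurable_iterates x) auto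
  then show ?thesis
    unfolding shadow_def
    by (intro borel_measurable_add A borel_measurable_scaleR measurable_const borel_measurable_sum) auto
qed

lemma measurable_average:
  assumes x: "x \<in> measurable V (restrict_space borel X)"
    and z: "\<And>k. k < T \<Longrightarrow> z k \<in> measurable V D"
  shows "(\<lambda>\<omega>. average (x \<omega>) (\<lambda>k. z k \<omega>)) \<in> measurable V (restrict_space borel X)"
proof (rule measurable_restrict_space2)
  show "(\<lambda>\<omega>. average (x \<omega>) (\<lambda>k. z k \<omega>)) \<in> borel_measurable V"
    unfolding average_def
    using measurable_iterates(1)[OF x, of _ z] z
    by (intro borel_measurable_scaleR measurable_const borel_measurable_sum)
      (auto simp: measurable_restrict_space2_iff)
  show "(\<lambda>\<omega>. average (x \<omega>) (\<lambda>k. z k \<omega>)) \<in> space V \<rightarrow> X"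
    using measurable_space[OF x] by (auto simp: space_restrict_space intro: average_in)
qed

lemma measurable_step_noise:
  "step_noise \<in> borel_measurable ((restrict_space borel X \<Otimes>\<^sub>M restrict_space borel Y \<Otimes>\<^sub>M borel) \<Otimes>\<^sub>M D)"
proof -
  let ?N = "(restrict_space borel X \<Otimes>\<^sub>M restrict_space borel Y \<Otimes>\<^sub>M (borel :: 'b measure)) \<Otimes>\<^sub>M D"
  have mx: "(\<lambda>p. fst (fst p)) \<in> measurable ?N (restrict_space borel X)"
    and my: "(\<lambda>p. fst (snd (fst p))) \<in> measurable ?N (restrict_space borel Y)"
    and mu: "(\<lambda>p. snd (snd (fst p))) \<in> borel_measurable ?N"
    and mz: "snd \<in> measurable ?N D" by measurable
  have mx': "(\<lambda>p. fst (fst p)) \<in> borel_measurable ?N" and my': "(\<lambda>p. fst (snd (fst p))) \<in> borel_measurable ?N"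
    using mx my by (blast intro: measurable_restrict_spaceD)+
  show ?thesis
    unfolding step_noise_def split_beta
    by (intro borel_measurable_add borel_measurable_inner borel_measurable_diff measurable_dx measurable_dy
        measurable_Gx measurable_Gy mx my mu mz mx' my' measurable_const) simp
qed

lemma integral_step_noise:
  assumes "x \<in> X" "y \<in> Y"
  shows "(\<integral>z. step_noise ((x, y, u), z) \<partial>D) = 0"
  using Gx_integrable[OF assms] Gy_integrable[OF assms]
  by (simp add: step_noise_def dx_def dy_def prob_space)

text \<open>Supplies the integrability of the noise. The sampled and mean directions are bounded,
  \<open>X\<close> and \<open>Y\<close> are bounded, and the shadow points stay within a fixed
  distance of \<open>A x\<close> over the \<open>T\<close> steps.\<close>

lemma step_noise_bounded:
  "\<exists>C. \<forall>x\<in>X. \<forall>z. \<forall>t\<le>T. (\<forall>k\<le>t. z k \<in> space D) \<longrightarrow>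
    \<bar>step_noise ((primal x z t, dual x z t, shadow x z t), z t)\<bar> \<le> C"
proof -
  obtain a b where a: "\<And>x. x \<in> X \<Longrightarrow> norm x \<le> a" and b: "\<And>y. y \<in> Y \<Longrightarrow> norm y \<le> b"
    using X(3) Y(3) unfolding bounded_iff by auto
  show ?thesis
  proof (intro exI ballI allI impI)
    fix x z t assume x: "x \<in> X" and t: "t \<le> T" and "\<forall>k\<le>t. z k \<in> space D"
    then have z: "\<And>k. k \<le> t \<Longrightarrow> z k \<in> space D" by blast
    let ?x = "primal x z t" and ?y = "dual x z t" and ?u = "shadow x z t"
    note xi = primal_in[OF x, of z t] and yi = dual_in[OF x, of z t]
    have Bx: "0 \<le> B\<^sub>x" and By: "0 \<le> B\<^sub>y"
      using norm_dx_le[OF xi yi] norm_dy_le[OF xi yi] norm_ge_zero order_trans by blast+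
    have "norm (dx ?x ?y - Gx ?x ?y (z t)) \<le> 2 * B\<^sub>x"
      using norm_triangle_ineq4[of "dx ?x ?y" "Gx ?x ?y (z t)"] norm_dx_le[OF xi yi] Gx_bound[OF xi yi z[of t]] by auto
    moreover have "norm (?x - xopt) \<le> a + a"
      using norm_triangle_ineq4[of ?x xopt] a[OF xi] a[OF minimizer] by auto
    ultimately have 1: "\<bar>(dx ?x ?y - Gx ?x ?y (z t)) \<bullet> (?x - xopt)\<bar> \<le> 2 * B\<^sub>x * (a + a)"
      using Bx by (intro order_trans[OF Cauchy_Schwarz_ineq2] mult_mono) auto
    have "norm (?u - ?y) \<le> norm (?u - A x) + norm (A x) + norm ?y"
      using norm_triangle_ineq4[of "?u - A x + A x" ?y] norm_triangle_ineq[of "?u - A x" "A x"] by simp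
    also have "norm (?u - A x) \<le> 2 * \<eta>\<^sub>y * B\<^sub>y * t"
      using z by (intro norm_shadow_diff_le x) auto
    also have "\<dots> \<le> 2 * \<eta>\<^sub>y * B\<^sub>y * T" using t \<eta>_pos By by (intro mult_left_mono) auto
    also have "norm (A x) \<le> b" by (rule b[OF A_in[OF x]])
    also have "norm ?y \<le> b" by (rule b[OF yi])
    finally have "norm (?u - ?y) \<le> 2 * \<eta>\<^sub>y * B\<^sub>y * T + b + b" by simp
    then have 2: "\<bar>(dy ?x ?y - Gy ?x ?y (z t)) \<bullet> (?u - ?y)\<bar> \<le> 2 * B\<^sub>y * (2 * \<eta>\<^sub>y * B\<^sub>y * T + b + b)"
      using By norm_dual_error_le[where z=z and t=t, OF x z[of t]] unfolding dual_error_def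
      by (intro order_trans[OF Cauchy_Schwarz_ineq2] mult_mono) auto
    show "\<bar>step_noise ((?x, ?y, ?u), z t)\<bar> \<le> 2 * B\<^sub>x * (a + a) + 2 * B\<^sub>y * (2 * \<eta>\<^sub>y * B\<^sub>y * T + b + b)"
      using 1 2 unfolding step_noise_def by simp
  qed
qed

text \<open>The set \<open>J\<close> holds the samples of earlier stages and \<open>\<kappa>\<close>
  enumerates those of the present one. Integrating the bound for single realizations removes the
  noise. The first conclusion records on which samples the average depends, so that the next stage
  can start from it.\<close>

lemma expected_average_gap_le:
  fixes W :: "'w measure" and Z :: "'i \<Rightarrow> 'w \<Rightarrow> 'c" and \<kappa> :: "nat \<Rightarrow> 'i"
  assumes W: "prob_space W" and ind: "prob_space.indep_vars W (\<lambda>_. D) Z I"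
    and J: "J \<subseteq> I" and \<kappa>: "\<And>t. t < T \<Longrightarrow> \<kappa> t \<in> I - J" "inj_on \<kappa> {..<T}"
    and distr: "\<And>t. t < T \<Longrightarrow> distr W D (Z (\<kappa> t)) = D"
    and x: "x \<in> measurable (history W D Z J) (restrict_space borel X)"
  defines "x1 \<equiv> (\<lambda>\<omega>. average (x \<omega>) (\<lambda>k. Z (\<kappa> k) \<omega>))"
  shows "x1 \<in> measurable (history W D Z (J \<union> \<kappa> ` {..<T})) (restrict_space borel X)"
    and "real T * (\<integral>\<omega>. P (x1 \<omega>) - P xopt \<partial>W) \<le>
      (\<integral>\<omega>. P (x \<omega>) - P xopt \<partial>W) / (\<mu> * \<eta>\<^sub>x)
      + 4 * K\<^sup>2 / (\<mu> * \<eta>\<^sub>y) * ((\<integral>\<omega>. P (x \<omega>) - P xopt \<partial>W) + (\<integral>\<omega>. P (x1 \<omega>) - P xopt \<partial>W))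
      + real T * (\<eta>\<^sub>x * B\<^sub>x\<^sup>2 / 2 + 5 * \<eta>\<^sub>y * B\<^sub>y\<^sup>2 / 2)"
proof -
  interpret W: prob_space W by fact
  let ?z = "\<lambda>\<omega> k. Z (\<kappa> k) \<omega>"
  let ?X = "restrict_space borel X" and ?Y = "restrict_space borel Y"
  let ?J = "\<lambda>t. J \<union> \<kappa> ` {..<t}"
  let ?S = "\<lambda>t \<omega>. (primal (x \<omega>) (?z \<omega>) t, dual (x \<omega>) (?z \<omega>) t, shadow (x \<omega>) (?z \<omega>) t)"
  have Z: "Z i \<in> measurable W D" if "i \<in> I" for i
    using ind that by (auto simp: W.indep_vars_def)
  have JI: "?J t \<subseteq> I" if "t \<le> T" for t using J \<kappa>(1) that by auto
  have xJ: "x \<in> measurable (history W D Z (?J t)) ?X" if "t \<le> T" for t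
    using JI[OF that] by (intro measurable_history_mono[OF x] Z) auto
  have zJ: "Z (\<kappa> k) \<in> measurable (history W D Z (?J t)) D" if "t \<le> T" "k < t" for t k
    using JI[OF that(1)] that(2) by (intro measurable_history_component Z) auto
  show x1: "x1 \<in> measurable (history W D Z (?J T)) ?X"
    unfolding x1_def by (intro measurable_average xJ zJ) auto
  have xW: "x \<in> measurable W ?X" using J by (intro measurable_historyD[OF x] Z) auto
  have x1W: "x1 \<in> measurable W ?X" using JI[of T] by (intro measurable_historyD[OF x1] Z) auto
  have S: "?S t \<in> measurable (history W D Z (?J t)) (?X \<Otimes>\<^sub>M ?Y \<Otimes>\<^sub>M borel)" if "t \<le> T" for t
    by (intro measurable_Pair measurable_iterates measurable_shadow xJ[OF that] zJ[OF that])
  have SW: "?S t \<in> measurable W (?X \<Otimes>\<^sub>M ?Y \<Otimes>\<^sub>M borel)" if "t \<le> T" for t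
    using JI[OF that] by (intro measurable_historyD[OF S[OF that]] Z) auto
  have x_in: "x \<omega> \<in> X" if "\<omega> \<in> space W" for \<omega>
    using measurable_space[OF xW that] by (simp add: space_restrict_space)
  have z_in: "?z \<omega> k \<in> space D" if "\<omega> \<in> space W" "k < T" for \<omega> k
    using measurable_space[OF Z that(1)] \<kappa>(1) that(2) by auto
  obtain C where C: "\<forall>x\<in>X. \<forall>z. \<forall>t\<le>T. (\<forall>k\<le>t. z k \<in> space D) \<longrightarrow>
    \<bar>step_noise ((primal x z t, dual x z t, shadow x z t), z t)\<bar> \<le> C"
    using step_noise_bounded by blast
  have noise_int: "integrable W (\<lambda>\<omega>. step_noise (?S t \<omega>, ?z \<omega> t))" if t: "t < T" for t
  proof (rule W.integrable_const_bound[where B=C])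
    show "AE \<omega> in W. norm (step_noise (?S t \<omega>, ?z \<omega> t)) \<le> C"
    proof (rule AE_I2)
      fix \<omega> assume "\<omega> \<in> space W"
      then show "norm (step_noise (?S t \<omega>, ?z \<omega> t)) \<le> C"
        using C[rule_format, of "x \<omega>" t "?z \<omega>"] x_in z_in t by simp
    qed
    show "(\<lambda>\<omega>. step_noise (?S t \<omega>, ?z \<omega> t)) \<in> borel_measurable W"
      using SW[of t] Z[of "\<kappa> t"] \<kappa>(1)[OF t] t
      by (intro measurable_compose[OF _ measurable_step_noise] measurable_Pair) auto
  qed
  \<comment> \<open>The state at step \<open>t\<close> depends on \<open>J\<close> and on the
    samples \<open>\<kappa> k\<close> with \<open>k < t\<close>; injectivity of
    \<open>\<kappa>\<close> makes the sample at \<open>\<kappa> t\<close> fresh.\<close>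
  have noise_0: "(\<integral>\<omega>. step_noise (?S t \<omega>, ?z \<omega> t) \<partial>W) = 0" if t: "t < T" for t
  proof (rule W.integral_fresh_sample_eq_0[OF ind _ _ _ S])
    show "?J t \<subseteq> I" "\<kappa> t \<in> I" "t \<le> T" using JI[of t] \<kappa>(1)[OF t] t by auto
    show "\<kappa> t \<notin> ?J t" using \<kappa>(1)[OF t] inj_onD[OF \<kappa>(2), of t] t by fastforce
    show "distr W D (Z (\<kappa> t)) = D" by (rule distr[OF t])
  qed (use t in \<open>auto simp: measurable_step_noise noise_int space_pair_measure space_restrict_space integral_step_noise\<close>)
  let ?\<delta>0 = "\<lambda>\<omega>. P (x \<omega>) - P xopt" and ?\<delta>1 = "\<lambda>\<omega>. P (x1 \<omega>) - P xopt"
  note int = integrable_gap[OF W xW] integrable_gap[OF W x1W]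
  define R where "R = real T * (\<eta>\<^sub>x * B\<^sub>x\<^sup>2 / 2 + 5 * \<eta>\<^sub>y * B\<^sub>y\<^sup>2 / 2)"
  have "real T * (\<integral>\<omega>. ?\<delta>1 \<omega> \<partial>W) = (\<integral>\<omega>. real T * ?\<delta>1 \<omega> \<partial>W)" by simp
  also have "\<dots> \<le> (\<integral>\<omega>. ?\<delta>0 \<omega> / (\<mu> * \<eta>\<^sub>x) + 4 * K\<^sup>2 / (\<mu> * \<eta>\<^sub>y) * (?\<delta>0 \<omega> + ?\<delta>1 \<omega>)
      + R + (\<Sum>t<T. step_noise (?S t \<omega>, ?z \<omega> t)) \<partial>W)"
  proof (rule integral_mono)
    show "integrable W (\<lambda>\<omega>. real T * ?\<delta>1 \<omega>)" by (intro integrable_mult_right int)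
    show "integrable W (\<lambda>\<omega>. ?\<delta>0 \<omega> / (\<mu> * \<eta>\<^sub>x) + 4 * K\<^sup>2 / (\<mu> * \<eta>\<^sub>y) * (?\<delta>0 \<omega> + ?\<delta>1 \<omega>)
      + R + (\<Sum>t<T. step_noise (?S t \<omega>, ?z \<omega> t)))"
      using noise_int by (intro Bochner_Integration.integrable_add integrable_divide integrable_mult_right int
          W.integrable_const Bochner_Integration.integrable_sum) auto
    fix \<omega> assume "\<omega> \<in> space W"
    then show "real T * ?\<delta>1 \<omega> \<le> ?\<delta>0 \<omega> / (\<mu> * \<eta>\<^sub>x) + 4 * K\<^sup>2 / (\<mu> * \<eta>\<^sub>y) * (?\<delta>0 \<omega> + ?\<delta>1 \<omega>)
      + R + (\<Sum>t<T. step_noise (?S t \<omega>, ?z \<omega> t))"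
      unfolding x1_def R_def by (intro average_gap_le_growth x_in z_in)
  qed
  also have "\<dots> = (\<integral>\<omega>. ?\<delta>0 \<omega> \<partial>W) / (\<mu> * \<eta>\<^sub>x)
      + 4 * K\<^sup>2 / (\<mu> * \<eta>\<^sub>y) * ((\<integral>\<omega>. ?\<delta>0 \<omega> \<partial>W) + (\<integral>\<omega>. ?\<delta>1 \<omega> \<partial>W))
      + R + (\<Sum>t<T. \<integral>\<omega>. step_noise (?S t \<omega>, ?z \<omega> t) \<partial>W)"
    (is "_ = ?R")
  proof -
    have "has_bochner_integral W (\<lambda>\<omega>. ?\<delta>0 \<omega> / (\<mu> * \<eta>\<^sub>x) + 4 * K\<^sup>2 / (\<mu> * \<eta>\<^sub>y) * (?\<delta>0 \<omega> + ?\<delta>1 \<omega>)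
      + R + (\<Sum>t<T. step_noise (?S t \<omega>, ?z \<omega> t))) ?R"
      using W.prob_space
      by (intro has_bochner_integral_add has_bochner_integral_divide_zero has_bochner_integral_mult_right
          has_bochner_integral_sum has_bochner_integral_integrable int noise_int)
        (simp_all add: has_bochner_integral_iff)
    then show ?thesis by (rule has_bochner_integral_integral_eq)
  qed
  also have "(\<Sum>t<T. \<integral>\<omega>. step_noise (?S t \<omega>, ?z \<omega> t) \<partial>W) = 0"
    using noise_0 by simp
  finally show "real T * (\<integral>\<omega>. ?\<delta>1 \<omega> \<partial>W) \<le> (\<integral>\<omega>. ?\<delta>0 \<omega> \<partial>W) / (\<mu> * \<eta>\<^sub>x)
      + 4 * K\<^sup>2 / (\<mu> * \<eta>\<^sub>y) * ((\<integral>\<omega>. ?\<delta>0 \<omega> \<partial>W) + (\<integral>\<omega>. ?\<delta>1 \<omega> \<partial>W))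
      + real T * (\<eta>\<^sub>x * B\<^sub>x\<^sup>2 / 2 + 5 * \<eta>\<^sub>y * B\<^sub>y\<^sup>2 / 2)" by (simp add: R_def)
qed

end

section \<open>Restarts\<close>

text \<open>Dividing by \<open>T\<close> and moving \<delta>1 / 9 to the left gives 8/9 * \<delta>1
  \<le> (1/18 + 1/9 + 2/15) * e = 3/10 * e, so \<delta>1 is at most 27/80 * e, below half of
  \<open>e\<close>.\<close>

lemma stage_gap_halves:
  fixes \<delta>0 \<delta>1 e a c T :: real
  assumes T: "T > 0" and \<delta>: "0 \<le> \<delta>0" "\<delta>0 \<le> e" "0 \<le> \<delta>1"
    and a: "a \<le> T / 18" and c: "c \<le> T / 9"
    and ineq: "T * \<delta>1 \<le> \<delta>0 * a + c * (\<delta>0 + \<delta>1) + T * (2 * e / 15)"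
  shows "\<delta>1 \<le> e / 2"
proof -
  have "\<delta>0 * a \<le> \<delta>0 * (T / 18)" using a \<delta> by (intro mult_left_mono) auto
  moreover have "c * (\<delta>0 + \<delta>1) \<le> T / 9 * (\<delta>0 + \<delta>1)" using c \<delta> by (intro mult_right_mono) auto
  moreover have "T * (\<delta>0 / 18 + (\<delta>0 + \<delta>1) / 9 + 2 * e / 15)
      = \<delta>0 * (T / 18) + T / 9 * (\<delta>0 + \<delta>1) + T * (2 * e / 15)" by (simp add: algebra_simps)
  ultimately have "T * \<delta>1 \<le> T * (\<delta>0 / 18 + (\<delta>0 + \<delta>1) / 9 + 2 * e / 15)"
    using ineq by linarith
  then have "\<delta>1 \<le> \<delta>0 / 18 + (\<delta>0 + \<delta>1) / 9 + 2 * e / 15" using T by simp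
  then show ?thesis using \<delta> by (simp add: field_simps)
qed

text \<open>Induction over the stages: the target gap and both step sizes halve while the length
  doubles, so every stage satisfies the same inequalities as the first.\<close>

lemma (in spd_problem) expected_stage_gap_le:
  fixes W :: "'w measure" and \<xi> :: "nat \<Rightarrow> nat \<Rightarrow> 'w \<Rightarrow> 'c"
  assumes W: "prob_space W"
    and ind: "prob_space.indep_vars W (\<lambda>_. D) (\<lambda>(s, t). \<xi> s t) (SIGMA s:{1..S}. {..<stage_length T1 s})"
    and distr: "\<And>s t. s \<in> {1..S} \<Longrightarrow> t < stage_length T1 s \<Longrightarrow> distr W D (\<xi> s t) = D"
    and x0: "x0 \<in> X" "P x0 - P xopt \<le> \<epsilon>0" and \<epsilon>0: "\<epsilon>0 > 0"
    and pos: "B\<^sub>x > 0" "B\<^sub>y > 0" "T1 > 0"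
    and T1: "405 * B\<^sub>x\<^sup>2 \<le> \<mu> * \<epsilon>0 * T1" "810 * K\<^sup>2 * B\<^sub>y\<^sup>2 \<le> \<mu> * \<epsilon>0 * T1"
  defines "xbar \<equiv> (\<lambda>s \<omega>. rspd_out X Y Gx Gy A (2 * \<epsilon>0 / (45 * B\<^sub>x\<^sup>2)) (2 * \<epsilon>0 / (45 * B\<^sub>y\<^sup>2)) T1 x0 (\<lambda>s t. \<xi> s t \<omega>) s)"
  shows "s \<le> S \<Longrightarrow> xbar s \<in> measurable W (restrict_space borel X) \<and>
    (\<integral>\<omega>. P (xbar s \<omega>) - P xopt \<partial>W) \<le> \<epsilon>0 / 2 ^ s"
proof -
  interpret W: prob_space W by fact
  let ?Z = "\<lambda>(s, t). \<xi> s t"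
  let ?J = "\<lambda>s. SIGMA s:{1..s}. {..<stage_length T1 s}"
  have Z: "?Z i \<in> measurable W D" if "i \<in> ?J S" for i
    using ind that unfolding W.indep_vars_def by blast
  have hist: "v \<in> measurable W N" if "v \<in> measurable (history W D ?Z (?J s)) N" "s \<le> S" for v N s
    by (rule measurable_historyD[OF that(1)]) (rule Z, use that(2) in auto)
  have nonneg: "0 \<le> (\<integral>\<omega>. P (v \<omega>) - P xopt \<partial>W)" if "v \<in> measurable W (restrict_space borel X)" for v
  proof (rule Bochner_Integration.integral_nonneg_AE, rule AE_I2)
    fix \<omega> assume "\<omega> \<in> space W"
    then have "v \<omega> \<in> X" using measurable_space[OF that] by (simp add: space_restrict_space)
    from growth[OF this] show "0 \<le> P (v \<omega>) - P xopt"
      using \<mu>_pos by (meson order_trans zero_le_power2 mult_nonneg_nonneg divide_nonneg_nonneg less_imp_le zero_le_numeral)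
  qed
  \<comment> \<open>Stronger than the goal: measurability in the history of the first
    \<open>s\<close> stages keeps the samples of the next stage fresh.\<close>
  have "xbar s \<in> measurable (history W D ?Z (?J s)) (restrict_space borel X) \<and>
      (\<integral>\<omega>. P (xbar s \<omega>) - P xopt \<partial>W) \<le> \<epsilon>0 / 2 ^ s" if "s \<le> S" for s
    using that
  proof (induction s)
    case 0
    have "xbar 0 = (\<lambda>_. x0)" by (simp add: xbar_def)
    then show ?case using x0 by (simp add: space_restrict_space W.prob_space)
  next
    case (Suc s)
    define e where "e = \<epsilon>0 / 2 ^ s"
    define T where "T = stage_length T1 (Suc s)"
    define \<eta>x where "\<eta>x = 2 * \<epsilon>0 / (45 * B\<^sub>x\<^sup>2) / 2 ^ s"
    define \<eta>y where "\<eta>y = 2 * \<epsilon>0 / (45 * B\<^sub>y\<^sup>2) / 2 ^ s"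
    have e: "e > 0" using \<epsilon>0 by (simp add: e_def)
    \<comment> \<open>The invariant that reduces the conditions for each stage to those on
      \<open>T1\<close>.\<close>
    have Te: "e * T = \<epsilon>0 * T1" by (simp add: e_def T_def stage_length_def)
    have \<eta>: "\<eta>x = 2 * e / (45 * B\<^sub>x\<^sup>2)" "\<eta>y = 2 * e / (45 * B\<^sub>y\<^sup>2)"
      by (simp_all add: \<eta>x_def \<eta>y_def e_def)
    interpret st: spd_steps D X Y f Gx Gy B\<^sub>x B\<^sub>y P A K \<mu> xopt \<eta>x \<eta>y T
      by unfold_locales (use pos \<epsilon>0 in \<open>auto simp: \<eta>x_def \<eta>y_def T_def stage_length_def\<close>)
    have Suc_xbar: "xbar (Suc s) = (\<lambda>\<omega>. st.average (xbar s \<omega>) (\<lambda>k. ?Z (Suc s, k) \<omega>))"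
      unfolding st.average_def st.primal_def by (simp add: xbar_def Let_def T_def \<eta>x_def \<eta>y_def)
    have J: "?J (Suc s) = ?J s \<union> Pair (Suc s) ` {..<T}"
      by (auto simp: T_def le_Suc_eq)
    have xs: "xbar s \<in> measurable (history W D ?Z (?J s)) (restrict_space borel X)"
      and IH: "(\<integral>\<omega>. P (xbar s \<omega>) - P xopt \<partial>W) \<le> e"
      using Suc by (auto simp: e_def)
    have stage: "xbar (Suc s) \<in> measurable (history W D ?Z (?J s \<union> Pair (Suc s) ` {..<T})) (restrict_space borel X)"
      "real T * (\<integral>\<omega>. P (xbar (Suc s) \<omega>) - P xopt \<partial>W) \<le>
      (\<integral>\<omega>. P (xbar s \<omega>) - P xopt \<partial>W) / (\<mu> * \<eta>x)
      + 4 * K\<^sup>2 / (\<mu> * \<eta>y) * ((\<integral>\<omega>. P (xbar s \<omega>) - P xopt \<partial>W) + (\<integral>\<omega>. P (xbar (Suc s) \<omega>) - P xopt \<partial>W))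
      + real T * (\<eta>x * B\<^sub>x\<^sup>2 / 2 + 5 * \<eta>y * B\<^sub>y\<^sup>2 / 2)"
      unfolding Suc_xbar
      by (rule st.expected_average_gap_le[OF W ind _ _ _ _ xs];
          use Suc.prems in \<open>auto simp: T_def inj_on_def intro!: distr\<close>)+
    have x1: "xbar (Suc s) \<in> measurable (history W D ?Z (?J (Suc s))) (restrict_space borel X)"
      unfolding J by (rule stage(1))
    have "(\<integral>\<omega>. P (xbar (Suc s) \<omega>) - P xopt \<partial>W) \<le> e / 2"
    proof (rule stage_gap_halves)
      show "0 < real T" by (simp add: st.T_pos)
      show "0 \<le> (\<integral>\<omega>. P (xbar s \<omega>) - P xopt \<partial>W)" "0 \<le> (\<integral>\<omega>. P (xbar (Suc s) \<omega>) - P xopt \<partial>W)"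
        using Suc.prems by (auto intro!: nonneg hist[OF xs] hist[OF x1])
      have T: "405 * B\<^sub>x\<^sup>2 \<le> \<mu> * (e * T)" "810 * K\<^sup>2 * B\<^sub>y\<^sup>2 \<le> \<mu> * (e * T)"
        unfolding Te using T1 by (simp_all add: mult.assoc)
      \<comment> \<open>Here 405 = 18 * 45 / 2, and below 810 = 9 * 4 * 45 / 2; the 45 / 2 comes
        from the step sizes.\<close>
      show "1 / (\<mu> * \<eta>x) \<le> real T / 18"
        using T(1) \<mu>_pos e pos by (simp add: \<eta> divide_simps mult_ac)
      show "4 * K\<^sup>2 / (\<mu> * \<eta>y) \<le> real T / 9"
        using T(2) \<mu>_pos e pos by (simp add: \<eta> divide_simps mult_ac)
      \<comment> \<open>The primal steps contribute e / 45, the dual and shadow steps 5 * e /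
        45.\<close>
      have "\<eta>x * B\<^sub>x\<^sup>2 / 2 + 5 * \<eta>y * B\<^sub>y\<^sup>2 / 2 = 2 * e / 15"
        using pos by (simp add: \<eta>)
      with stage(2) show "real T * (\<integral>\<omega>. P (xbar (Suc s) \<omega>) - P xopt \<partial>W) \<le>
        (\<integral>\<omega>. P (xbar s \<omega>) - P xopt \<partial>W) * (1 / (\<mu> * \<eta>x))
        + 4 * K\<^sup>2 / (\<mu> * \<eta>y) * ((\<integral>\<omega>. P (xbar s \<omega>) - P xopt \<partial>W) + (\<integral>\<omega>. P (xbar (Suc s) \<omega>) - P xopt \<partial>W))
        + real T * (2 * e / 15)" by simp
    qed (rule IH)
    then show ?case using x1 by (simp add: e_def)
  qed
  then show "s \<le> S \<Longrightarrow> xbar s \<in> measurable W (restrict_space borel X) \<and>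
    (\<integral>\<omega>. P (xbar s \<omega>) - P xopt \<partial>W) \<le> \<epsilon>0 / 2 ^ s"
    using hist by blast
qed

section \<open>Boundedness and the dual map\<close>

text \<open>By Cauchy-Schwarz, a subgradient at either of two points limits how far the function
  drops towards the other.\<close>

lemma bounded_subgradients_lipschitz:
  fixes h :: "'a::real_inner \<Rightarrow> real"
  assumes sub: "\<And>x. x \<in> S \<Longrightarrow> \<exists>v\<in>subgradients S h x. norm v \<le> C" and C: "0 \<le> C"
  shows "C-lipschitz_on S h"
proof (rule lipschitz_onI)
  have "h x - C * norm (z - x) \<le> h z" if xz: "x \<in> S" "z \<in> S" for x z
  proof -
    obtain v where "v \<in> subgradients S h x" and v: "norm v \<le> C" using sub[OF xz(1)] by blast
    then have "h x + v \<bullet> (z - x) \<le> h z" using xz by (auto simp: subgradients_def)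
    moreover have "\<bar>v \<bullet> (z - x)\<bar> \<le> C * norm (z - x)"
      using v by (intro order_trans[OF Cauchy_Schwarz_ineq2] mult_right_mono) auto
    ultimately show ?thesis by linarith
  qed
  from this this show "dist (h x) (h z) \<le> C * dist x z" if "x \<in> S" "z \<in> S" for x z
    using that by (smt (verit) dist_norm dist_real_def norm_minus_commute)
qed (rule C)

text \<open>Strong convexity forces quadratic growth away from a point, while bounded subgradients
  allow linear growth only. At distance r this reads c / 2 * r^2 \<le> 2 * C * r, hence r \<le> 4 *
  C / c.\<close>

lemma strongly_convex_bounded_subgradients_imp_bounded:
  fixes h :: "'a::real_inner \<Rightarrow> real"
  assumes sub: "\<And>x. x \<in> S \<Longrightarrow> \<exists>v\<in>subgradients S h x. norm v \<le> C" and C: "0 \<le> C"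
    and sc: "strongly_convex_on S c h" "c > 0"
  shows "bounded S"
proof (cases "S = {}")
  case False
  then obtain x where x: "x \<in> S" by auto
  obtain v where v: "v \<in> subgradients S h x" "norm v \<le> C" using sub[OF x] by blast
  show ?thesis
    unfolding bounded_def
  proof (intro exI ballI)
    fix z assume z: "z \<in> S"
    have "h z \<ge> h x + v \<bullet> (z - x) + c / 2 * (norm (z - x))\<^sup>2"
      using sc(1) x z v(1) unfolding strongly_convex_on_def by blast
    moreover have "\<bar>v \<bullet> (z - x)\<bar> \<le> C * norm (z - x)"
      using v by (intro order_trans[OF Cauchy_Schwarz_ineq2] mult_right_mono) auto
    moreover have "h z - h x \<le> C * norm (z - x)"
      using lipschitz_onD[OF bounded_subgradients_lipschitz[OF sub C] z x] by (simp add: dist_norm)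
    ultimately have "norm (z - x) * (c / 2 * norm (z - x)) \<le> norm (z - x) * (2 * C)"
      by (simp add: power2_eq_square algebra_simps)
    then have "z = x \<or> c / 2 * norm (z - x) \<le> 2 * C"
      by (cases "z = x") (simp_all only: mult_le_cancel_left_pos zero_less_norm_iff right_minus_eq simp_thms)
    then show "dist x z \<le> 4 * C / c"
      using sc(2) C by (auto simp: dist_norm norm_minus_commute field_simps)
  qed
qed simp

text \<open>\<open>arg_max_on\<close> is a choice and says something only if a maximizer exists;
  compactness provides one.\<close>

lemma dual_map_maximizes:
  assumes "compact Y" "Y \<noteq> {}" "continuous_on Y phis"
  shows "dual_map Y l phis x \<in> Y"
    and "y \<in> Y \<Longrightarrow> y \<bullet> l x - phis y \<le> dual_map Y l phis x \<bullet> l x - phis (dual_map Y l phis x)"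
proof -
  have "continuous_on Y (\<lambda>y. y \<bullet> l x - phis y)"
    by (intro continuous_intros assms(3))
  from continuous_attains_sup[OF assms(1,2) this]
  obtain y0 where "y0 \<in> Y" "\<forall>y\<in>Y. y \<bullet> l x - phis y \<le> y0 \<bullet> l x - phis y0"
    by blast
  then have "is_arg_max (\<lambda>y. y \<bullet> l x - phis y) (\<lambda>y. y \<in> Y) y0"
    unfolding is_arg_max_def by (meson not_le)
  then have "is_arg_max (\<lambda>y. y \<bullet> l x - phis y) (\<lambda>y. y \<in> Y) (dual_map Y l phis x)"
    unfolding dual_map_def arg_max_on_def arg_max_def by (rule someI)
  then show "dual_map Y l phis x \<in> Y"
    and "y \<in> Y \<Longrightarrow> y \<bullet> l x - phis y \<le> dual_map Y l phis x \<bullet> l x - phis (dual_map Y l phis x)"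
    by (auto simp: is_arg_max_def not_less)
qed

text \<open>Optimality makes \<open>u1\<close> and \<open>u2\<close> subgradients of
  \<open>h\<close> at \<open>y1\<close> and \<open>y2\<close>. Adding the two strong convexity
  inequalities gives strong monotonicity, and Cauchy-Schwarz finishes.\<close>

lemma strongly_convex_maximizers_dist_le:
  assumes sc: "strongly_convex_on Y c h" "c > 0" and y: "y1 \<in> Y" "y2 \<in> Y"
    and max: "\<And>y. y \<in> Y \<Longrightarrow> y \<bullet> u1 - h y \<le> y1 \<bullet> u1 - h y1" "\<And>y. y \<in> Y \<Longrightarrow> y \<bullet> u2 - h y \<le> y2 \<bullet> u2 - h y2"
  shows "norm (y1 - y2) \<le> norm (u1 - u2) / c"
proof -
  have "u1 \<in> subgradients Y h y1" "u2 \<in> subgradients Y h y2"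
    using max by (auto simp: subgradients_def inner_diff_right inner_commute algebra_simps)
  then have "h y2 \<ge> h y1 + u1 \<bullet> (y2 - y1) + c / 2 * (norm (y2 - y1))\<^sup>2"
    and "h y1 \<ge> h y2 + u2 \<bullet> (y1 - y2) + c / 2 * (norm (y1 - y2))\<^sup>2"
    using sc(1) y unfolding strongly_convex_on_def by blast+
  then have "c * (norm (y1 - y2))\<^sup>2 \<le> (u1 - u2) \<bullet> (y1 - y2)"
    by (simp add: norm_minus_commute inner_diff field_simps)
  also have "\<dots> \<le> norm (u1 - u2) * norm (y1 - y2)" by (rule norm_cauchy_schwarz)
  finally have "norm (y1 - y2) * (c * norm (y1 - y2)) \<le> norm (y1 - y2) * norm (u1 - u2)"
    by (simp add: power2_eq_square mult_ac)
  then have "y1 = y2 \<or> c * norm (y1 - y2) \<le> norm (u1 - u2)"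
    by (cases "y1 = y2") (simp_all only: mult_le_cancel_left_pos zero_less_norm_iff right_minus_eq simp_thms)
  then show ?thesis using sc(2) by (auto simp: field_simps)
qed

section \<open>Iteration count\<close>

text \<open>The logarithm is positive, so the conversion to \<open>nat\<close> loses nothing, and
  rounding up costs at most a factor 2.\<close>

lemma num_stages_bounds:
  assumes "0 < \<epsilon>" "\<epsilon> < \<epsilon>0"
  shows "\<epsilon>0 / \<epsilon> \<le> 2 ^ num_stages \<epsilon>0 \<epsilon>" and "2 ^ num_stages \<epsilon>0 \<epsilon> \<le> 2 * (\<epsilon>0 / \<epsilon>)"
proof -
  let ?S = "num_stages \<epsilon>0 \<epsilon>"
  have q: "\<epsilon>0 / \<epsilon> > 1" using assms by simp
  then have "log 2 (\<epsilon>0 / \<epsilon>) > 0" by simp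
  then have S: "log 2 (\<epsilon>0 / \<epsilon>) \<le> real ?S" "real ?S \<le> log 2 (\<epsilon>0 / \<epsilon>) + 1"
    unfolding num_stages_def by linarith+
  have "\<epsilon>0 / \<epsilon> = 2 powr log 2 (\<epsilon>0 / \<epsilon>)" using q by (simp add: powr_log_cancel)
  also have "\<dots> \<le> 2 powr real ?S" using S by (intro powr_mono) auto
  finally show "\<epsilon>0 / \<epsilon> \<le> 2 ^ ?S" by (simp add: powr_realpow)
  have "2 powr real ?S \<le> 2 powr (log 2 (\<epsilon>0 / \<epsilon>) + 1)" using S by (intro powr_mono) auto
  also have "\<dots> = 2 * (\<epsilon>0 / \<epsilon>)" using q by (simp add: powr_add)
  finally show "2 ^ ?S \<le> 2 * (\<epsilon>0 / \<epsilon>)" by (simp add: powr_realpow)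
qed

lemma total_iterations_le:
  "total_iterations M B L G \<epsilon>0 \<mu> \<epsilon> \<le> 2 ^ num_stages \<epsilon>0 \<epsilon> * first_stage_length M B L G \<mu> \<epsilon>0"
proof -
  \<comment> \<open>The geometric sum is completed by one more \<open>T\<close>, which avoids
    subtraction.\<close>
  have "(\<Sum>s=1..S. stage_length T s) + T = 2 ^ S * T" for S T
    by (induction S) (auto simp: stage_length_def)
  then show ?thesis unfolding total_iterations_def by (metis le_add1)
qed

text \<open>The principal filter makes the bound uniform over the whole rectangle. Rounding up the
  first stage length adds up to 2 * \<epsilon>0 / \<epsilon> iterations, which is O(1 / (\<mu> *
  \<epsilon>)) because \<mu> stays below \<open>\<mu>max\<close>.\<close>

lemma total_iterations_bigo:
  assumes \<epsilon>0: "\<epsilon>0 > 0" and \<mu>max: "\<mu>max > 0"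
  shows "(\<lambda>(\<mu>, \<epsilon>). real (total_iterations M B L G \<epsilon>0 \<mu> \<epsilon>))
    \<in> O[principal ({0<..\<mu>max} \<times> {0<..<\<epsilon>0})](\<lambda>(\<mu>, \<epsilon>). 1 / (\<mu> * \<epsilon>))"
proof (rule bigoI)
  define C where "C = max (405 * M\<^sup>2) (810 * L\<^sup>2 * G\<^sup>2 * B\<^sup>2)"
  have C: "C \<ge> 0" by (simp add: C_def le_max_iff_disj)
  have "real (total_iterations M B L G \<epsilon>0 \<mu> \<epsilon>) \<le> (2 * C + 2 * \<epsilon>0 * \<mu>max) * (1 / (\<mu> * \<epsilon>))"
    if \<mu>: "0 < \<mu>" "\<mu> \<le> \<mu>max" and \<epsilon>: "0 < \<epsilon>" "\<epsilon> < \<epsilon>0" for \<mu> \<epsilon>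
  proof -
    have "C / (\<mu> * \<epsilon>0) \<ge> 0" using C \<mu> \<epsilon>0 by simp
    then have T: "real (first_stage_length M B L G \<mu> \<epsilon>0) \<le> C / (\<mu> * \<epsilon>0) + 1"
      unfolding first_stage_length_def C_def[symmetric] by linarith
    have "real (total_iterations M B L G \<epsilon>0 \<mu> \<epsilon>)
        \<le> real (2 ^ num_stages \<epsilon>0 \<epsilon> * first_stage_length M B L G \<mu> \<epsilon>0)"
      by (intro of_nat_mono total_iterations_le)
    also have "\<dots> = 2 ^ num_stages \<epsilon>0 \<epsilon> * real (first_stage_length M B L G \<mu> \<epsilon>0)" by simp
    also have "\<dots> \<le> 2 * (\<epsilon>0 / \<epsilon>) * (C / (\<mu> * \<epsilon>0) + 1)"
      using num_stages_bounds(2)[OF \<epsilon>] T \<epsilon> by (intro mult_mono) auto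
    also have "\<dots> = (2 * C + 2 * \<epsilon>0 * \<mu>) * (1 / (\<mu> * \<epsilon>))"
      using \<mu> \<epsilon> \<epsilon>0 by (simp add: field_simps)
    also have "\<dots> \<le> (2 * C + 2 * \<epsilon>0 * \<mu>max) * (1 / (\<mu> * \<epsilon>))"
      using \<mu> \<epsilon> \<epsilon>0 by (intro mult_right_mono add_left_mono mult_left_mono) auto
    finally show ?thesis .
  qed
  then show "\<forall>\<^sub>F p in principal ({0<..\<mu>max} \<times> {0<..<\<epsilon>0}).
      norm (case p of (\<mu>, \<epsilon>) \<Rightarrow> real (total_iterations M B L G \<epsilon>0 \<mu> \<epsilon>))
      \<le> (2 * C + 2 * \<epsilon>0 * \<mu>max) * norm (case p of (\<mu>, \<epsilon>) \<Rightarrow> 1 / (\<mu> * \<epsilon>))"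
    by (auto simp: eventually_principal)
qed

theorem theorem2:
  fixes X :: "(real^'d) set" and Y :: "(real^'n) set"
    and l :: "real^'d \<Rightarrow> real^'n" and g :: "real^'d \<Rightarrow> real"
    and phi phis :: "real^'n \<Rightarrow> real"
    and f :: "real^'d \<Rightarrow> real^'n \<Rightarrow> real" and P :: "real^'d \<Rightarrow> real"
    and D :: "'c measure" and \<Omega> :: "'w measure"
    and Gx :: "real^'d \<Rightarrow> real^'n \<Rightarrow> 'c \<Rightarrow> real^'d"
    and Gy :: "real^'d \<Rightarrow> real^'n \<Rightarrow> 'c \<Rightarrow> real^'n"
    and \<xi> :: "nat \<Rightarrow> nat \<Rightarrow> 'w \<Rightarrow> 'c"
    and x0 :: "real^'d" and M B L G lam \<mu> \<epsilon>0 \<epsilon> :: real and S T1 :: nat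
  assumes X: "closed X" "convex X"
    and l: "\<forall>i. convex_on X (\<lambda>x. l x $ i)" "\<forall>i. lsc_on X (\<lambda>x. l x $ i)"
    and g: "convex_on X g" "lsc_on X g"
    and Y: "closed Y" "convex_on Y phis"
    and conj: "convex_conjugate (extend_infty Y phis) = (\<lambda>u. ereal (phi u))"
              "convex_conjugate (\<lambda>u. ereal (phi u)) = extend_infty Y phis"
    and Y_nonneg: "\<not> affine_map_on X l \<longrightarrow> Y \<subseteq> {y. \<forall>i. 0 \<le> y $ i}"
    and f: "f = saddle_fun l phis g"
    and P: "P = primal_fun l phi g"
    and minimizer: "{x\<in>X. \<forall>z\<in>X. P x \<le> P z} \<noteq> {}"
    and D: "prob_space D"
    and Gx_measurable: "(\<lambda>(x, y, z). Gx x y z) \<in>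
          borel_measurable (restrict_space borel X \<Otimes>\<^sub>M restrict_space borel Y \<Otimes>\<^sub>M D)"
    and Gy_measurable: "(\<lambda>(x, y, z). Gy x y z) \<in>
          borel_measurable (restrict_space borel X \<Otimes>\<^sub>M restrict_space borel Y \<Otimes>\<^sub>M D)"
    and Gx_unbiased: "\<forall>x\<in>X. \<forall>y\<in>Y. (\<integral>z. Gx x y z \<partial>D) \<in> subgradients X (\<lambda>x'. f x' y) x"
    and Gy_unbiased: "\<forall>x\<in>X. \<forall>y\<in>Y. (\<integral>z. Gy x y z \<partial>D) \<in> supergradients Y (\<lambda>y'. f x y') y"
    and MB_pos: "M > 0" "B > 0"
    and x0: "x0 \<in> X" "\<epsilon>0 > 0" "P x0 - (INF x\<in>X. P x) \<le> \<epsilon>0"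
    and Gx_bound: "\<forall>x\<in>X. \<forall>y\<in>Y. \<forall>z\<in>space D. norm (Gx x y z) \<le> M"
    and Gy_bound: "\<forall>x\<in>X. \<forall>y\<in>Y. \<forall>z\<in>space D. norm (Gy x y z) \<le> B"
    and phis_strongly_convex: "lam > 0" "strongly_convex_on Y lam phis"
    and L: "L = 1 / lam"
    and l_lipschitz: "G-lipschitz_on X l"
    and P_strongly_convex: "\<mu> > 0" "strongly_convex_on X \<mu> P"
    and eps: "0 < \<epsilon>" "\<epsilon> < \<epsilon>0"
    and S: "S = num_stages \<epsilon>0 \<epsilon>"
    and T1: "T1 = first_stage_length M B L G \<mu> \<epsilon>0"
    and \<Omega>: "prob_space \<Omega>"
    and \<xi>_indep: "prob_space.indep_vars \<Omega> (\<lambda>_. D) (\<lambda>(s, t). \<xi> s t)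
                   (SIGMA s:{1..S}. {..<stage_length T1 s})"
    and \<xi>_distr: "\<forall>s\<in>{1..S}. \<forall>t<stage_length T1 s. distr \<Omega> D (\<xi> s t) = D"
  shows "(let xbar = (\<lambda>\<omega>. rspd_out X Y Gx Gy (dual_map Y l phis)
                          (2 * \<epsilon>0 / (45 * M\<^sup>2)) (2 * \<epsilon>0 / (45 * B\<^sup>2)) T1 x0 (\<lambda>s t. \<xi> s t \<omega>) S)
          in integrable \<Omega> (\<lambda>\<omega>. P (xbar \<omega>) - (INF x\<in>X. P x)) \<and>
             (\<integral>\<omega>. P (xbar \<omega>) - (INF x\<in>X. P x) \<partial>\<Omega>) \<le> \<epsilon>) \<and>
         (\<forall>\<mu>max>0. (\<lambda>(\<mu>', \<epsilon>'). real (total_iterations M B L G \<epsilon>0 \<mu>' \<epsilon>'))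
            \<in> O[principal ({0<..\<mu>max} \<times> {0<..<\<epsilon>0})](\<lambda>(\<mu>', \<epsilon>'). 1 / (\<mu>' * \<epsilon>')))"
proof -

  \<comment> \<open>From the hypotheses on the data to the abstract saddle problem\<close>
  interpret O: saddle_oracle D X Y f Gx Gy M B
    by (intro saddle_oracle.intro saddle_oracle_axioms.intro D)
      (use Gx_measurable Gy_measurable Gx_unbiased Gy_unbiased Gx_bound Gy_bound in auto)
  let ?A = "dual_map Y l phis"
  note Y_ne = primal_fun_eq_SUP(1)[OF conj(1)]
  have f_eq: "f x y = y \<bullet> l x - phis y + g x" for x y by (simp add: f saddle_fun_def)

  have phis_sub: "\<exists>v\<in>subgradients Y phis y. norm v \<le> norm (l x0) + B" if y: "y \<in> Y" for y
  proof (rule bexI)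
    \<comment> \<open>At the fixed point \<open>x0\<close>, the dual objective is a linear function
      minus \<open>phis\<close>, so its supergradient yields a subgradient of
      \<open>phis\<close>.\<close>
    show "l x0 - O.dy x0 y \<in> subgradients Y phis y"
      using O.dy_supergradient[OF x0(1) y]
      by (auto simp: subgradients_def f_eq inner_diff inner_commute algebra_simps)
    show "norm (l x0 - O.dy x0 y) \<le> norm (l x0) + B"
      using norm_triangle_ineq4[of "l x0" "O.dy x0 y"] O.norm_dy_le[OF x0(1) y] by simp
  qed
  have C: "0 \<le> norm (l x0) + B" using MB_pos by simp
  have Y_bounded: "bounded Y"
    by (rule strongly_convex_bounded_subgradients_imp_bounded[OF phis_sub C phis_strongly_convex(2,1)])
  have Y_compact: "compact Y" using Y(1) Y_bounded by (simp add: compact_eq_bounded_closed)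
  have phis_cont: "continuous_on Y phis"
    by (rule lipschitz_on_continuous_on[OF bounded_subgradients_lipschitz[OF phis_sub C]])
  note A = dual_map_maximizes[OF Y_compact Y_ne phis_cont, where l=l]

  have P_le: "f x y \<le> P x" if "y \<in> Y" for x y
    unfolding f P by (rule primal_fun_eq_SUP(2)[OF conj(1) that])
  have P_eq: "P x = f x (?A x)" for x
  proof (rule antisym)
    show "P x \<le> f x (?A x)"
      unfolding P primal_fun_eq_SUP(3)[OF conj(1)] f[symmetric]
      using A(2)[of _ x] Y_ne by (intro cSUP_least) (auto simp: f_eq)
  qed (rule P_le[OF A(1)])
  have P_sub: "\<exists>v\<in>subgradients X P x. norm v \<le> M" if x: "x \<in> X" for x
  proof (rule bexI)
    \<comment> \<open>Danskin's argument: \<open>f\<close> at the maximizing dual point touches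
      \<open>P\<close> at \<open>x\<close> and lies below it elsewhere, so its subgradient in the
      primal variable is one of \<open>P\<close>.\<close>
    show "O.dx x (?A x) \<in> subgradients X P x"
      using order_trans[OF O.dx_subgradient[OF x A(1)] P_le[OF A(1)]]
      unfolding subgradients_def P_eq[of x] by blast
    show "norm (O.dx x (?A x)) \<le> M" by (rule O.norm_dx_le[OF x A(1)])
  qed
  have X_bounded: "bounded X"
    using MB_pos
    by (intro strongly_convex_bounded_subgradients_imp_bounded[OF P_sub _ P_strongly_convex(2,1)]) auto
  have P_cont: "continuous_on X P"
    using MB_pos by (intro lipschitz_on_continuous_on[OF bounded_subgradients_lipschitz[OF P_sub]]) auto
  have A_lip: "(L * G)-lipschitz_on X ?A"
  proof (rule lipschitz_onI)
    fix x z assume xz: "x \<in> X" "z \<in> X"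
    have "norm (?A x - ?A z) \<le> norm (l x - l z) / lam"
      by (rule strongly_convex_maximizers_dist_le[OF phis_strongly_convex(2,1) A(1) A(1) A(2) A(2)])
    also have "\<dots> \<le> G * dist x z / lam"
      using lipschitz_onD[OF l_lipschitz xz] phis_strongly_convex(1)
      by (intro divide_right_mono) (auto simp: dist_norm)
    finally show "dist (?A x) (?A z) \<le> L * G * dist x z" by (simp add: L dist_norm)
  qed (use L phis_strongly_convex(1) lipschitz_on_nonneg[OF l_lipschitz] in simp)

  obtain xopt where xopt: "xopt \<in> X" "\<And>z. z \<in> X \<Longrightarrow> P xopt \<le> P z" using minimizer by auto
  have INF_P: "(INF x\<in>X. P x) = P xopt"
    using xopt by (intro cInf_eq_minimum) auto
  have growth: "\<mu> / 2 * (norm (x - xopt))\<^sup>2 \<le> P x - P xopt" if "x \<in> X" for x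
  proof -
    \<comment> \<open>With the zero subgradient, strong convexity at the minimizer is quadratic
      growth.\<close>
    have "0 \<in> subgradients X P xopt" using xopt by (simp add: subgradients_def)
    then show ?thesis
      using P_strongly_convex(2) that xopt(1) unfolding strongly_convex_on_def by fastforce
  qed
  interpret spd: spd_problem D X Y f Gx Gy M B P ?A "L * G" \<mu> xopt
    by unfold_locales
      (use X X_bounded Y Y_bounded P_le P_eq P_cont A(1) A_lip xopt growth P_strongly_convex in
        \<open>auto intro: convex_on_imp_convex\<close>)

  \<comment> \<open>The prescribed stage lengths and number of stages\<close>
  define C1 where "C1 = max (405 * M\<^sup>2) (810 * L\<^sup>2 * G\<^sup>2 * B\<^sup>2)"
  have "C1 / (\<mu> * \<epsilon>0) > 0"
    using MB_pos P_strongly_convex(1) x0(2) by (simp add: C1_def less_max_iff_disj)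
  then have "real T1 > 0" and "C1 / (\<mu> * \<epsilon>0) \<le> real T1"
    unfolding T1 first_stage_length_def C1_def[symmetric] by linarith+
  then have T1_pos: "T1 > 0" and C1_le: "C1 \<le> \<mu> * \<epsilon>0 * T1"
    using P_strongly_convex(1) x0(2) by (auto simp: field_simps)

  let ?xbar = "\<lambda>\<omega>. rspd_out X Y Gx Gy ?A (2 * \<epsilon>0 / (45 * M\<^sup>2)) (2 * \<epsilon>0 / (45 * B\<^sup>2)) T1 x0 (\<lambda>s t. \<xi> s t \<omega>) S"
  have out: "?xbar \<in> measurable \<Omega> (restrict_space borel X) \<and> (\<integral>\<omega>. P (?xbar \<omega>) - P xopt \<partial>\<Omega>) \<le> \<epsilon>0 / 2 ^ S"
  proof (rule spd.expected_stage_gap_le[OF \<Omega> \<xi>_indep _ x0(1) _ x0(2) MB_pos T1_pos])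
    show "405 * M\<^sup>2 \<le> \<mu> * \<epsilon>0 * T1" "810 * (L * G)\<^sup>2 * B\<^sup>2 \<le> \<mu> * \<epsilon>0 * T1"
      using C1_le by (simp_all add: C1_def power_mult_distrib mult.assoc)
  qed (use \<xi>_distr x0 INF_P in auto)
  \<comment> \<open>The number of stages is chosen so that \<open>S\<close> halvings bring
    \<epsilon>0 down to \<epsilon>.\<close>
  moreover have "\<epsilon>0 / 2 ^ S \<le> \<epsilon>"
    using num_stages_bounds(1)[OF eps] eps by (simp add: S field_simps)
  ultimately have "(\<integral>\<omega>. P (?xbar \<omega>) - (INF x\<in>X. P x) \<partial>\<Omega>) \<le> \<epsilon>"
    unfolding INF_P by linarith
  moreover have "integrable \<Omega> (\<lambda>\<omega>. P (?xbar \<omega>) - (INF x\<in>X. P x))"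
    unfolding INF_P using out by (intro spd.integrable_gap \<Omega>) auto
  ultimately show ?thesis
    unfolding Let_def using total_iterations_bigo[OF x0(2)] by blast
qed

end
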